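(* Let $(S_n)_{n\ge0}$ be the Dynamic Elephant Random Walk with $p\le 3/4$ or $\ell_{\sup}(\alpha)<\frac{1}{4p-2}$. For all $x\in\mathcal{X}$, if $p<1$ and $\ell_{\inf}(\alpha)>0$, then $$\frac{S_n-\mathbb{E}_x[S_n]}{a_nA_n}\xrightarrow{\ \mathcal{D}\ }\mathcal{N}(0,1)\quad\text{as }n\to\infty,$$ with convergence in distribution under $\mathbb{P}_x$, where $$a_n=\prod_{j=1}^{n-1}\Bigl(1+\frac{(2p-1)g(\alpha,j+1)}{j}\Bigr),\qquad A_n\ge0,\quad A_n^2=\sum_{k=1}^n\frac{1}{a_k^2}\bigl(1-\mathbb{E}_x[X_k]^2\bigr),$$ and $\ell_{\inf}(\alpha)=\liminf_{n\to\infty}g(\alpha,n)$, $\ell_{\sup}(\alpha)=\limsup_{n\to\infty}g(\alpha,n)$.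
   Context: Dynamic Elephant Random Walk (DERW). Let $(\mathcal{X},\mathscr{A},\mu)$ be a probability space and $T:\mathcal{X}\to\mathcal{X}$ a measurable $\mu$-preserving map ($\mu(T^{-1}A)=\mu(A)$ for all $A\in\mathscr{A}$); $T^n$ denotes the $n$-fold iterate. Let $f:\mathcal{X}\to[0,1]$ be $\mathscr{A}$-measurable. Let $p,q\in[0,1]$, let $g:R\subset\mathbb{R}\times\mathbb{N}\to[0,1]$ be a function and fix $\alpha\in\mathbb{R}$ with $(\alpha,n)\in R$ for all $n\ge1$; write $\alpha_n:=g(\alpha,n)\in[0,1]$. For $x\in\mathcal{X}$, the DERW under the probability $\mathbb{P}_x$ (expectation $\mathbb{E}_x$) is the process $S_0=0$, $S_n=\sum_{i=1}^n X_i$, with $\{-1,1\}$-valued increments such that $\mathbb{P}_x[X_1=1]=\alpha_1 q+(1-\alpha_1)f(Tx)$ and, for $n\ge1$, $\eta\in\{-1,1\}$, with $\mathscr{F}_n=\sigma(X_1,\dots,X_n)$, $$\mathbb{P}_x[X_{n+1}=\eta\mid\mathscr{F}_n]=\alpha_{n+1}\,\frac{1}{2n}\sum_{k=1}^{n}\bigl(1+(2p-1)X_k\eta\bigr)+(1-\alpha_{n+1})\,d_{n+1}(\eta),$$ where $d_m(1)=f(T^m x)$ and $d_m(-1)=1-f(T^m x)$. Standing assumption: the case where both $g(\alpha,2)=1$ and $p=0$ is excluded (so that $a_n>0$ for all $n$; $a_1=1$ as an empty product). *)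

theory Defs
  imports "HOL-Probability.Probability"
begin

text \<open>The sigma-algebra generated by \<open>X 1, \<dots>, X n\<close> on the space of \<open>M\<close>; only the sets of
  the resulting measure matter.\<close>

definition history :: "'w measure \<Rightarrow> (nat \<Rightarrow> 'w \<Rightarrow> real) \<Rightarrow> nat \<Rightarrow> 'w measure" where
  "history M X n =
     sigma (space M) {X k -` B \<inter> space M | k B. k \<in> {1..n} \<and> B \<in> sets borel}"

text \<open>\<open>d m \<eta>\<close> is the step law dictated by the dynamical system; it is used for
  \<open>\<eta> \<in> {- 1, 1}\<close> only.\<close>

definition dyn_step :: "('x \<Rightarrow> 'x) \<Rightarrow> ('x \<Rightarrow> real) \<Rightarrow> 'x \<Rightarrow> nat \<Rightarrow> real \<Rightarrow> real" where
  "dyn_step T f x m \<eta> = (if \<eta> = 1 then f ((T ^^ m) x) else 1 - f ((T ^^ m) x))"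

text \<open>The steps \<open>X 1, X 2, \<dots>\<close> live on one measurable space \<open>\<Omega>\<close>, which carries a probability
  measure \<open>P x\<close> for every point \<open>x\<close> of the dynamical system. The index \<open>0\<close> of \<open>X\<close> is not used.\<close>

locale derw = prob_space \<mu>
  for \<mu> :: "'x measure"
  and T :: "'x \<Rightarrow> 'x"
  and f :: "'x \<Rightarrow> real"
  and p q :: real
  and R :: "(real \<times> nat) set"
  and g :: "real \<Rightarrow> nat \<Rightarrow> real"
  and \<alpha> :: real
  and \<Omega> :: "'w measure"
  and P :: "'x \<Rightarrow> 'w measure"
  and X :: "nat \<Rightarrow> 'w \<Rightarrow> real" +
  assumes T_measurable: "T \<in> measurable \<mu> \<mu>"
    and T_preserving: "\<And>A. A \<in> sets \<mu> \<Longrightarrow> emeasure \<mu> (T -` A \<inter> space \<mu>) = emeasure \<mu> A"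
    and f_measurable: "f \<in> borel_measurable \<mu>"
    and f_range: "\<And>x. x \<in> space \<mu> \<Longrightarrow> f x \<in> {0..1}"
    and p_range: "p \<in> {0..1}"
    and q_range: "q \<in> {0..1}"
    and g_range: "\<And>a n. (a, n) \<in> R \<Longrightarrow> g a n \<in> {0..1}"
    and \<alpha>_dom: "\<And>n. n \<ge> 1 \<Longrightarrow> (\<alpha>, n) \<in> R"
    and nondegenerate: "\<not> (g \<alpha> 2 = 1 \<and> p = 0)"
    and P_prob: "\<And>x. x \<in> space \<mu> \<Longrightarrow> prob_space (P x)"
    and P_sets: "\<And>x. x \<in> space \<mu> \<Longrightarrow> sets (P x) = sets \<Omega>"
    and X_measurable: "\<And>n. n \<ge> 1 \<Longrightarrow> X n \<in> borel_measurable \<Omega>"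
    and X_range: "\<And>n \<omega>. n \<ge> 1 \<Longrightarrow> \<omega> \<in> space \<Omega> \<Longrightarrow> X n \<omega> \<in> {- 1, 1}"
    and X_first: "\<And>x. x \<in> space \<mu> \<Longrightarrow>
      measure (P x) {\<omega> \<in> space \<Omega>. X 1 \<omega> = 1} = g \<alpha> 1 * q + (1 - g \<alpha> 1) * f (T x)"
    and X_next: "\<And>x n \<eta>. x \<in> space \<mu> \<Longrightarrow> n \<ge> 1 \<Longrightarrow> \<eta> \<in> {- 1, 1} \<Longrightarrow>
      AE \<omega> in P x.
        real_cond_exp (P x) (history (P x) X n)
            (indicator {\<omega>' \<in> space \<Omega>. X (n + 1) \<omega>' = \<eta>}) \<omega>
        = g \<alpha> (n + 1) * (1 / (2 * real n) * (\<Sum>k = 1..n. 1 + (2 * p - 1) * X k \<omega> * \<eta>))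
          + (1 - g \<alpha> (n + 1)) * dyn_step T f x (n + 1) \<eta>"

definition walk :: "(nat \<Rightarrow> 'w \<Rightarrow> real) \<Rightarrow> nat \<Rightarrow> 'w \<Rightarrow> real" where
  "walk X n \<omega> = (\<Sum>i = 1..n. X i \<omega>)"

definition a_coeff :: "real \<Rightarrow> (real \<Rightarrow> nat \<Rightarrow> real) \<Rightarrow> real \<Rightarrow> nat \<Rightarrow> real" where
  "a_coeff p g \<alpha> n = (\<Prod>j\<in>{1..<n}. 1 + (2 * p - 1) * g \<alpha> (j + 1) / real j)"

definition A_coeff ::
  "real \<Rightarrow> (real \<Rightarrow> nat \<Rightarrow> real) \<Rightarrow> real \<Rightarrow> 'w measure \<Rightarrow> (nat \<Rightarrow> 'w \<Rightarrow> real) \<Rightarrow> nat \<Rightarrow> real" where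
  "A_coeff p g \<alpha> M X n =
     sqrt (\<Sum>k = 1..n. 1 / (a_coeff p g \<alpha> k)\<^sup>2 * (1 - (integral\<^sup>L M (X k))\<^sup>2))"

definition ell_inf :: "(real \<Rightarrow> nat \<Rightarrow> real) \<Rightarrow> real \<Rightarrow> ereal" where
  "ell_inf g \<alpha> = liminf (\<lambda>n. ereal (g \<alpha> n))"

definition ell_sup :: "(real \<Rightarrow> nat \<Rightarrow> real) \<Rightarrow> real \<Rightarrow> ereal" where
  "ell_sup g \<alpha> = limsup (\<lambda>n. ereal (g \<alpha> n))"

end

theory Submission
  imports Defs "HOL-Library.Landau_Symbols"
begin

text \<open>
  Since the steps are \<open>\<plusminus>1\<close>-valued, the law of the walk says that the conditional mean of
  \<open>X (n + 1)\<close> is an affine function of \<open>S n / n\<close>. Hence \<open>M n = (S n - E S n) / a n\<close> is a martingale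
  whose increments are bounded by \<open>4 / a n\<close> and whose conditional variances are
  \<open>(1 - c\<^sup>2) / (a n)\<^sup>2\<close>, where \<open>c\<close> is the conditional mean of \<open>X n\<close> and differs from its expectation
  by at most \<open>\<bar>S m - E S m\<bar> / m\<close> with \<open>m = n - 1\<close>. The characteristic function of \<open>M n / A n\<close>
  is compared step by step with the Gaussian one. The error of one step is \<open>1 / (a k)\<^sup>2 / (A n)\<^sup>2\<close> times
  a null sequence, because \<open>E \<bar>S k - E S k\<bar> = o(k)\<close> and \<open>1 / (a k)\<^sup>2 = o((A k)\<^sup>2)\<close>. The hypothesis on
  \<open>p\<close> or the upper limit makes \<open>(2 p - 1) g(\<alpha>, n) \<le> 1 / 2\<close> eventually, so that \<open>(a n)\<^sup>2 = O(n)\<close>;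
  the hypothesis on \<open>p\<close> and the lower limit keeps \<open>\<bar>E X n\<bar>\<close> away from \<open>1\<close>. Together they give
  \<open>A n \<longrightarrow> \<infinity>\<close>, and a Toeplitz averaging argument makes the total error vanish.
\<close>

section \<open>Growth of the normalising sequences\<close>

text \<open>A Toeplitz argument: the terms before the relation takes hold add up to a constant,
  which the diverging sum of \<open>w\<close> absorbs, and the later terms are bounded one by
  one.\<close>

lemma sum_smallo:
  fixes y w :: "nat \<Rightarrow> real"
  assumes y: "y \<in> o(w)" and w: "\<And>k. 0 \<le> w k"
    and div: "filterlim (\<lambda>n. \<Sum>k<n. w k) at_top sequentially"
  shows "(\<lambda>n. \<Sum>k<n. y k) \<in> o(\<lambda>n. \<Sum>k<n. w k)"
proof (rule landau_o.smallI)
  fix c :: real assume c: "c > 0"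
  have "\<forall>\<^sub>F k in sequentially. norm (y k) \<le> c / 2 * norm (w k)"
    using landau_o.smallD[OF y, of "c / 2"] c by simp
  then obtain K where K: "\<And>k. k \<ge> K \<Longrightarrow> \<bar>y k\<bar> \<le> c / 2 * w k"
    using w by (auto simp: eventually_sequentially)
  \<comment> \<open>The threshold makes the initial block at most half of the allowed error; the
    factor \<open>c / 2\<close> for the tail takes the other half.\<close>
  have "\<forall>\<^sub>F n in sequentially. 2 / c * (\<Sum>k<K. \<bar>y k\<bar>) \<le> (\<Sum>k<n. w k)"
    using div by (auto simp: filterlim_at_top)
  then show "\<forall>\<^sub>F n in sequentially. norm (\<Sum>k<n. y k) \<le> c * norm (\<Sum>k<n. w k)"
    using eventually_ge_at_top[of K]
  proof eventually_elim
    case (elim n)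
    have split: "{..<n} = {..<K} \<union> {K..<n}" using elim by auto
    have "\<bar>\<Sum>k<n. y k\<bar> \<le> (\<Sum>k<n. \<bar>y k\<bar>)" by (rule sum_abs)
    also have "\<dots> = (\<Sum>k<K. \<bar>y k\<bar>) + (\<Sum>k=K..<n. \<bar>y k\<bar>)"
      unfolding split by (rule sum.union_disjoint) auto
    also have "(\<Sum>k=K..<n. \<bar>y k\<bar>) \<le> (\<Sum>k=K..<n. c / 2 * w k)"
      by (rule sum_mono) (use K in auto)
    also have "\<dots> \<le> (\<Sum>k<n. c / 2 * w k)"
      by (rule sum_mono2) (use w c in auto)
    also have "\<dots> = c / 2 * (\<Sum>k<n. w k)" by (simp add: sum_distrib_left)
    also have "(\<Sum>k<K. \<bar>y k\<bar>) \<le> c / 2 * (\<Sum>k<n. w k)"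
      using elim c by (simp add: field_simps)
    finally show ?case using w by (simp add: sum_nonneg)
  qed
qed

text \<open>Kept apart from \<open>growth\<close> so that walks can share the bound on
  \<open>\<beta>\<close> without any growth condition.\<close>

locale coefficients =
  fixes \<beta> :: "nat \<Rightarrow> real"
  assumes \<beta>_abs: "\<And>n. \<bar>\<beta> n\<bar> \<le> 1"

text \<open>At \<open>n = 0\<close> division by zero gives 0, so the recursion says
  \<open>a 1 = a 0\<close>, as for empty products.\<close>

locale growth = coefficients +
  fixes a :: "nat \<Rightarrow> real"
  assumes \<beta>_half: "\<forall>\<^sub>F n in sequentially. \<beta> n \<le> 1 / 2"
    and a_pos: "\<And>n. 0 < a n"
    and a_Suc: "\<And>n. a (Suc n) = a n * (1 + \<beta> n / real n)"
begin

text \<open>With \<open>\<beta> n\<close> at most 1/2 the square is at most 1 + 1/n + 1/(4 n^2),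
  which lies below 1 + 1/(n - 1). The product of the bounds \<open>real n / (real n - 1)\<close>
  telescopes to linear growth.\<close>

lemma factor_sq_le: "\<forall>\<^sub>F n in sequentially. (1 + \<beta> n / real n)\<^sup>2 \<le> real n / (real n - 1)"
  using \<beta>_half eventually_ge_at_top[of 2]
proof eventually_elim
  case (elim n)
  have "(1 + \<beta> n / real n)\<^sup>2 \<le> (1 + 1 / (2 * real n))\<^sup>2"
  proof (rule power_mono)
    show "0 \<le> 1 + \<beta> n / real n" using \<beta>_abs[of n] elim by (simp add: field_simps)
    show "1 + \<beta> n / real n \<le> 1 + 1 / (2 * real n)" using elim by (simp add: field_simps)
  qed
  also have "\<dots> = (2 * real n + 1)\<^sup>2 / (2 * real n)\<^sup>2"
    using elim by (simp add: field_simps power2_eq_square)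
  also have "\<dots> \<le> real n / (real n - 1)"
  proof -
    \<comment> \<open>The left side expands to 4 n^3 - 3 n - 1.\<close>
    have "(2 * real n + 1)\<^sup>2 * (real n - 1) \<le> (2 * real n)\<^sup>2 * real n"
      using elim by (simp add: algebra_simps power2_eq_square)
    then show ?thesis using elim by (simp add: divide_simps mult_ac)
  qed
  finally show ?case .
qed

text \<open>The sequence \<open>n / (a (n + 1))\<^sup>2\<close> is eventually nondecreasing.\<close>

lemma inverse_sq_lower: "\<exists>\<gamma>>0. \<forall>\<^sub>F n in sequentially. \<gamma> / real n \<le> 1 / (a (Suc n))\<^sup>2"
proof -
  obtain K where K: "\<And>n. n \<ge> K \<Longrightarrow> (1 + \<beta> n / real n)\<^sup>2 \<le> real n / (real n - 1)"
    using factor_sq_le by (auto simp: eventually_sequentially)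
  \<comment> \<open>Starting at a positive index makes \<open>\<gamma>\<close> positive.\<close>
  define L where "L = Suc K"
  define \<gamma> where "\<gamma> = real L / (a (Suc L))\<^sup>2"
  have "\<gamma> \<le> real n / (a (Suc n))\<^sup>2" if "n \<ge> L" for n
    using that
  proof (induction n rule: dec_induct)
    case base
    show ?case by (simp add: \<gamma>_def)
  next
    case (step n)
    have n: "n \<ge> 1" "Suc n \<ge> K" using step by (auto simp: L_def)
    have "real n * (1 + \<beta> (Suc n) / real (Suc n))\<^sup>2 \<le> real (Suc n)"
      using mult_left_mono[OF K[of "Suc n"], of "real n"] n by simp
    then have "real n * (1 + \<beta> (Suc n) / real (Suc n))\<^sup>2 * (a (Suc n))\<^sup>2 \<le> real (Suc n) * (a (Suc n))\<^sup>2"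
      by (rule mult_right_mono) simp
    then have "real n * (a (Suc (Suc n)))\<^sup>2 \<le> real (Suc n) * (a (Suc n))\<^sup>2"
      by (simp add: a_Suc[of "Suc n"] power_mult_distrib mult_ac)
    then have "real n / (a (Suc n))\<^sup>2 \<le> real (Suc n) / (a (Suc (Suc n)))\<^sup>2"
      using a_pos by (simp add: divide_simps less_imp_neq[symmetric] del: of_nat_Suc)
    with step show ?case by simp
  qed
  moreover have "\<gamma> > 0"
    unfolding \<gamma>_def using a_pos[of "Suc L"]
    by (intro divide_pos_pos zero_less_power) (simp_all add: L_def)
  ultimately show ?thesis
    by (intro exI[of _ \<gamma>] conjI eventually_sequentiallyI[of L])
      (auto simp: field_simps L_def a_pos less_imp_neq[symmetric])
qed

text \<open>Relative to the new value, the increment is one minus the square of a growth factor,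
  hence O(1/n) because \<open>\<beta>\<close> is bounded.\<close>

lemma inverse_sq_increment:
  "(\<lambda>n. 1 / (a (Suc (Suc n)))\<^sup>2 - 1 / (a (Suc n))\<^sup>2) \<in> o(\<lambda>n. 1 / (a (Suc (Suc n)))\<^sup>2)"
proof -
  let ?b = "\<lambda>n. 1 / (a (Suc n))\<^sup>2"
  have "?b n - ?b (Suc n) = ?b (Suc n) * ((1 + \<beta> (Suc n) / real (Suc n))\<^sup>2 - 1)" for n
  proof -
    have *: "1 / x\<^sup>2 - 1 / (x * r)\<^sup>2 = 1 / (x * r)\<^sup>2 * (r\<^sup>2 - 1)" if "x * r > 0" for x r :: real
    proof -
      have "x \<noteq> 0" "r \<noteq> 0" using that by auto
      then show ?thesis by (simp add: field_simps)
    qed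
    show ?thesis
      using *[of "a (Suc n)" "1 + \<beta> (Suc n) / real (Suc n)"] a_pos[of "Suc (Suc n)"]
      unfolding a_Suc[of "Suc n"] by simp
  qed
  moreover have "\<bar>(1 + \<beta> (Suc n) / real (Suc n))\<^sup>2 - 1\<bar> \<le> 3 / real (Suc n)" for n
  proof -
    let ?u = "\<beta> (Suc n) / real (Suc n)"
    have u: "\<bar>?u\<bar> \<le> 1 / real (Suc n)" using \<beta>_abs[of "Suc n"]
      by (simp add: abs_divide divide_right_mono del: of_nat_Suc)
    have "\<bar>?u\<bar> \<le> 1" using u by (rule order_trans) simp
    have *: "(1 + u)\<^sup>2 - 1 = u * (2 + u)" for u :: real
      by (simp add: power2_eq_square algebra_simps)
    have "\<bar>(1 + ?u)\<^sup>2 - 1\<bar> = \<bar>?u\<bar> * \<bar>2 + ?u\<bar>"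
      using *[of ?u] by (simp add: abs_mult)
    also have "\<dots> \<le> (1 / real (Suc n)) * 3"
    proof (rule mult_mono)
      show "\<bar>2 + ?u\<bar> \<le> 3" using \<open>\<bar>?u\<bar> \<le> 1\<close> by linarith
    qed (use u in auto)
    finally show ?thesis by simp
  qed
  ultimately have *: "norm (?b (Suc n) - ?b n) \<le> norm (?b (Suc n)) * (3 / real (Suc n))" for n
    unfolding norm_minus_commute[of "?b (Suc n)"]
    by (simp only: abs_mult real_norm_def mult_left_mono abs_ge_zero)
  have "(\<lambda>n. ?b (Suc n) - ?b n) \<in> O(\<lambda>n. ?b (Suc n) * (3 / real (Suc n)))"
    using * by (intro bigoI[of _ 1]) (auto simp: abs_mult simp del: of_nat_Suc)
  also have "(\<lambda>n. ?b (Suc n) * (3 / real (Suc n))) \<in> o(\<lambda>n. ?b (Suc n) * 1)"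
    by (intro landau_o.big_small_mult smalloI_tendsto)
       (auto intro!: LIMSEQ_Suc[OF lim_const_over_n] simp del: of_nat_Suc)
  finally show ?thesis by simp
qed

text \<open>A discrete Gronwall argument: dividing by \<open>real n - 1\<close> absorbs the growth
  factor, so each step adds only 1/n. Thus \<open>v n\<close> is at most \<open>n\<close> times a
  harmonic sum, up to constants. It is applied to the second moment of the centred walk.\<close>

lemma second_moment_sublinear:
  fixes v :: "nat \<Rightarrow> real"
  assumes v_nonneg: "\<And>n. 0 \<le> v n"
    and v_Suc: "\<And>n. v (Suc n) \<le> (1 + \<beta> n / real n)\<^sup>2 * v n + 1"
  shows "(\<lambda>n. v n / (real n)\<^sup>2) \<longlonglongrightarrow> 0"
proof -
  obtain K0 where K0: "\<And>n. n \<ge> K0 \<Longrightarrow> (1 + \<beta> n / real n)\<^sup>2 \<le> real n / (real n - 1)"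
    using factor_sq_le by (auto simp: eventually_sequentially)
  define K where "K = max K0 2"
  define C where "C = v K / (real K - 1)"
  have bound: "v n / (real n - 1) \<le> C + (\<Sum>k<n. 1 / real k)" if "n \<ge> K" for n
    using that
  proof (induction n rule: dec_induct)
    case base
    show ?case by (simp add: C_def sum_nonneg)
  next
    case (step n)
    have n: "n \<ge> 2" "n \<ge> K0" using step by (auto simp: K_def)
    have "v (Suc n) \<le> real n / (real n - 1) * v n + 1"
      using v_Suc[of n] mult_right_mono[OF K0[OF n(2)] v_nonneg[of n]] by linarith
    then have "v (Suc n) / real n \<le> (real n / (real n - 1) * v n + 1) / real n"
      by (rule divide_right_mono) simp
    also have "\<dots> = v n / (real n - 1) + 1 / real n"
      using n by (simp add: add_divide_distrib)
    finally have "v (Suc n) / real n \<le> v n / (real n - 1) + 1 / real n" .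
    with step show ?case by simp
  qed
  \<comment> \<open>Averages of the null sequence 1/k tend to 0, so no logarithmic estimate of the
    harmonic sums is required.\<close>
  have "(\<lambda>n. \<Sum>k<n. 1 / real k) \<in> o(\<lambda>n. \<Sum>k<n. 1)"
    by (intro sum_smallo smalloI_tendsto)
      (auto intro!: lim_1_over_n filterlim_real_sequentially)
  then have "(\<lambda>n. (\<Sum>k<n. 1 / real k) / real n) \<longlonglongrightarrow> 0"
    by (auto dest: smalloD_tendsto)
  from tendsto_add[OF lim_const_over_n[of C] this]
  have lim: "(\<lambda>n. (C + (\<Sum>k<n. 1 / real k)) / real n) \<longlonglongrightarrow> 0"
    by (simp add: add_divide_distrib)
  show ?thesis
  proof (rule tendsto_sandwich[OF _ _ tendsto_const lim])
    show "\<forall>\<^sub>F n in sequentially. v n / (real n)\<^sup>2 \<le> (C + (\<Sum>k<n. 1 / real k)) / real n"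
      using eventually_ge_at_top[of K]
    proof eventually_elim
      case (elim n)
      have n: "real n \<ge> 2" using elim by (simp add: K_def)
      have "v n / (real n)\<^sup>2 = v n / real n / real n"
        by (simp add: power2_eq_square)
      also have "\<dots> \<le> v n / (real n - 1) / real n"
        using n v_nonneg by (intro divide_right_mono divide_left_mono) auto
      also have "\<dots> \<le> (C + (\<Sum>k<n. 1 / real k)) / real n"
        using bound[OF elim] by (rule divide_right_mono) simp
      finally show ?case .
    qed
  qed (simp add: v_nonneg)
qed

end

text \<open>The sequence \<open>s\<close> models the increments of the squared normalisation;
  \<open>s k\<close> belongs to step \<open>Suc k\<close>, which is why it is compared with
  \<open>a (Suc k)\<close>.\<close>

locale growth_variance = growth +
  fixes s :: "nat \<Rightarrow> real" and \<epsilon> :: real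
  assumes \<epsilon>_pos: "0 < \<epsilon>"
    and s_nonneg: "\<And>k. 0 \<le> s k"
    and s_lower: "\<forall>\<^sub>F k in sequentially. \<epsilon> / (a (Suc k))\<^sup>2 \<le> s k"
begin

lemma inverse_sq_bigo: "(\<lambda>k. 1 / (a (Suc k))\<^sup>2) \<in> O(s)"
proof (rule bigoI[of _ "1 / \<epsilon>"])
  show "\<forall>\<^sub>F k in sequentially. norm (1 / (a (Suc k))\<^sup>2) \<le> 1 / \<epsilon> * norm (s k)"
    using s_lower by eventually_elim (use s_nonneg \<epsilon>_pos in \<open>auto simp: field_simps\<close>)
qed

text \<open>By \<open>inverse_sq_lower\<close>, \<open>s\<close> eventually dominates a positive
  multiple of the harmonic series.\<close>

lemma sum_s_at_top: "filterlim (\<lambda>n. \<Sum>k<n. s k) at_top sequentially"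
proof (rule ccontr)
  assume *: "\<not> ?thesis"
  have mono: "incseq (\<lambda>n. \<Sum>k<n. s k)"
    by (intro incseq_SucI) (simp add: s_nonneg)
  \<comment> \<open>Nondecreasing partial sums that do not tend to infinity are bounded.\<close>
  have "summable s"
  proof -
    obtain Z where Z: "\<not> (\<forall>\<^sub>F n in sequentially. Z \<le> (\<Sum>k<n. s k))"
      using * by (auto simp: filterlim_at_top)
    have "(\<Sum>k<n. s k) \<le> Z" for n
    proof (rule ccontr)
      assume "\<not> (\<Sum>k<n. s k) \<le> Z"
      then have "Z \<le> (\<Sum>k<m. s k)" if "m \<ge> n" for m
        using incseqD[OF mono that] by simp
      with Z show False by (auto simp: eventually_sequentially)
    qed
    then show ?thesis using s_nonneg by (intro summableI_nonneg_bounded) auto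
  qed
  obtain \<gamma> where \<gamma>: "\<gamma> > 0" "\<forall>\<^sub>F n in sequentially. \<gamma> / real n \<le> 1 / (a (Suc n))\<^sup>2"
    using inverse_sq_lower by blast
  have "\<forall>\<^sub>F n in sequentially. norm (\<epsilon> * \<gamma> * (1 / real n)) \<le> s n"
    using \<gamma>(2) s_lower
  proof eventually_elim
    case (elim n)
    have "\<epsilon> * (\<gamma> / real n) \<le> \<epsilon> * (1 / (a (Suc n))\<^sup>2)"
      using elim \<epsilon>_pos by (intro mult_left_mono) auto
    then show ?case using elim \<epsilon>_pos \<gamma>(1) by (simp add: abs_mult)
  qed
  then have "summable (\<lambda>n. \<epsilon> * \<gamma> * (1 / real n))"
    by (rule summable_comparison_test_ev) fact
  then have "summable (\<lambda>n. 1 / real n)"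
    using \<gamma>(1) \<epsilon>_pos by (subst (asm) summable_cmult_iff) auto
  then show False using not_summable_harmonic[where 'a = real] by (simp add: inverse_eq_divide)
qed

text \<open>The increments of \<open>1 / a\<^sup>2\<close> are \<open>o(s)\<close>, so their sums are \<open>o\<close> of the sums of \<open>s\<close>.\<close>

lemma inverse_sq_smallo_sum: "(\<lambda>n. 1 / (a (Suc n))\<^sup>2) \<in> o(\<lambda>n. \<Sum>k<Suc n. s k)"
proof -
  let ?b = "\<lambda>n. 1 / (a (Suc n))\<^sup>2"
  \<comment> \<open>The shift matches \<open>inverse_sq_increment\<close>, which measures an
    increment against the later of its two values.\<close>
  define w where "w = (\<lambda>k. s (Suc k))"
  have sum_w: "(\<Sum>k<n. w k) = (\<Sum>k<Suc n. s k) - s 0" for n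
    by (subst sum.lessThan_Suc_shift) (simp add: w_def)
  have top: "filterlim (\<lambda>n. \<Sum>k<Suc n. s k) at_top sequentially"
    using sum_s_at_top by (subst filterlim_sequentially_Suc)
  have top_w: "filterlim (\<lambda>n. \<Sum>k<n. w k) at_top sequentially"
    unfolding sum_w using filterlim_tendsto_add_at_top[OF tendsto_const[of "- s 0"] top] by simp
  have const: "(\<lambda>_. c) \<in> o(\<lambda>n. \<Sum>k<Suc n. s k)" for c :: real
  proof -
    have "(\<lambda>_. 1 :: real) \<in> o(\<lambda>n. \<Sum>k<Suc n. s k)"
      using filterlim_at_top_imp_at_infinity[OF top]
      by (simp add: smallomega_iff_smallo[symmetric] smallomega_1_conv_filterlim del: sum.lessThan_Suc)
    then show ?thesis using cmult_in_smallo_iff[of c "\<lambda>_. 1"] unfolding mult_1_right by blast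
  qed
  have "(\<lambda>n. ?b (Suc n) - ?b n) \<in> o(w)"
  proof -
    have "(\<lambda>n. ?b (Suc n)) \<in> O(w)"
      unfolding w_def using inverse_sq_bigo by (rule landau_o.big.compose) (rule filterlim_Suc)
    with inverse_sq_increment show ?thesis by (rule landau_o.small_big_trans)
  qed
  then have "(\<lambda>n. \<Sum>k<n. ?b (Suc k) - ?b k) \<in> o(\<lambda>n. \<Sum>k<n. w k)"
    using top_w by (intro sum_smallo) (auto simp: w_def s_nonneg)
  also have "(\<lambda>n. \<Sum>k<n. w k) \<in> O(\<lambda>n. \<Sum>k<Suc n. s k)"
  proof (intro bigoI[of _ 1] always_eventually allI)
    fix n
    have "0 \<le> (\<Sum>k<n. w k)" by (simp add: w_def s_nonneg sum_nonneg)
    then show "norm (\<Sum>k<n. w k) \<le> 1 * norm (\<Sum>k<Suc n. s k)"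
      using sum_w[of n] s_nonneg[of 0] by (simp del: sum.lessThan_Suc)
  qed
  \<comment> \<open>The increments telescope; the remaining constant \<open>?b 0\<close> is
    negligible against a diverging sum.\<close>
  finally have "(\<lambda>n. ?b n - ?b 0) \<in> o(\<lambda>n. \<Sum>k<Suc n. s k)"
    by (subst (asm) sum_lessThan_telescope[of ?b])
  from sum_in_smallo(1)[OF this const[of "?b 0"]] show ?thesis by simp
qed

end

section \<open>Walks with affine conditional mean\<close>

text \<open>The upper bound on \<open>exp (- u)\<close> is the reciprocal of the quadratic Taylor
  bound for \<open>exp u\<close>: the two quadratics multiply to 1 + u^4/4, which is at least 1. The
  lower bound is the tangent line.\<close>

lemma exp_minus_quadratic:
  fixes u :: real
  assumes "0 \<le> u"
  shows "\<bar>1 - exp (- u) - u\<bar> \<le> u\<^sup>2 / 2"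
proof -
  have "(1 + u + u\<^sup>2 / 2) * (1 - u + u\<^sup>2 / 2) = 1 + u ^ 4 / 4"
    by (simp add: field_simps power2_eq_square power4_eq_xxxx)
  moreover have "0 < 1 + u + u\<^sup>2 / 2" using assms by (simp add: add_pos_nonneg)
  ultimately have "1 / (1 + u + u\<^sup>2 / 2) \<le> 1 - u + u\<^sup>2 / 2"
    by (simp add: divide_le_eq mult.commute)
  moreover have "exp (- u) \<le> 1 / (1 + u + u\<^sup>2 / 2)"
    using exp_lower_Taylor_quadratic[OF assms] \<open>0 < 1 + u + u\<^sup>2 / 2\<close>
    by (simp add: exp_minus inverse_eq_divide divide_left_mono)
  moreover have "1 - u \<le> exp (- u)" using exp_ge_add_one_self[of "- u"] by simp
  ultimately show ?thesis by (simp add: abs_le_iff)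
qed

section \<open>The sigma-algebra of the first steps\<close>

lemma space_history [simp]: "space (history M X n) = space M"
  by (simp add: history_def space_measure_of_conv)

lemma sets_history:
  "sets (history M X n) =
     sigma_sets (space M) {X k -` B \<inter> space M | k B. k \<in> {1..n} \<and> B \<in> sets borel}"
  unfolding history_def by (rule sets_measure_of) auto

lemma measurable_history:
  "1 \<le> k \<Longrightarrow> k \<le> n \<Longrightarrow> X k \<in> borel_measurable (history M X n)"
proof (rule measurableI)
  fix B :: "real set" assume "1 \<le> k" "k \<le> n" "B \<in> sets borel"
  then show "X k -` B \<inter> space (history M X n) \<in> sets (history M X n)"
    unfolding sets_history space_history by (intro sigma_sets.Basic) auto
qed simp

lemma subalgebra_history:
  assumes "\<And>k. 1 \<le> k \<Longrightarrow> X k \<in> borel_measurable M"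
  shows "subalgebra M (history M X n)"
  unfolding subalgebra_def sets_history
proof (intro conjI sets.sigma_sets_subset subsetI)
  fix A assume "A \<in> {X k -` B \<inter> space M | k B. k \<in> {1..n} \<and> B \<in> sets borel}"
  then obtain k B where "k \<in> {1..n}" "B \<in> sets borel" "A = X k -` B \<inter> space M" by blast
  then show "A \<in> sets M" using measurable_sets[OF assms] by auto
qed simp

text \<open>For \<open>n = 0\<close> the convention \<open>x / 0 = 0\<close> makes the last assumption say that the conditional mean
  of \<open>X 1\<close> is its expectation.\<close>

locale linear_walk = prob_space N + coefficients \<beta>
  for N :: "'w measure" and \<beta> :: "nat \<Rightarrow> real" +
  fixes X :: "nat \<Rightarrow> 'w \<Rightarrow> real"
  assumes X_measurable: "\<And>n. n \<ge> 1 \<Longrightarrow> X n \<in> borel_measurable N"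
    and X_range: "\<And>n \<omega>. n \<ge> 1 \<Longrightarrow> \<omega> \<in> space N \<Longrightarrow> X n \<omega> \<in> {- 1, 1}"
    and linear_mean: "\<And>n h B. h \<in> borel_measurable (history N X n) \<Longrightarrow>
      (\<And>\<omega>. \<omega> \<in> space N \<Longrightarrow> \<bar>h \<omega>\<bar> \<le> B) \<Longrightarrow>
      expectation (\<lambda>\<omega>. h \<omega> * X (Suc n) \<omega>) =
      expectation (\<lambda>\<omega>. h \<omega> * (expectation (X (Suc n)) +
        \<beta> n * (walk X n \<omega> - expectation (walk X n)) / real n))"
begin

definition dev :: "nat \<Rightarrow> 'w \<Rightarrow> real" where
  "dev n \<omega> = walk X n \<omega> - expectation (walk X n)"

text \<open>By \<open>linear_mean\<close> this is the conditional mean of step \<open>Suc n\<close>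
  given the first \<open>n\<close> steps, so \<open>incr\<close> is a martingale difference.\<close>

definition drift :: "nat \<Rightarrow> 'w \<Rightarrow> real" where
  "drift n \<omega> = expectation (X (Suc n)) + \<beta> n * dev n \<omega> / real n"

definition incr :: "nat \<Rightarrow> 'w \<Rightarrow> real" where
  "incr n \<omega> = X (Suc n) \<omega> - drift n \<omega>"

lemma subalg: "subalgebra N (history N X n)"
  using X_measurable by (rule subalgebra_history)

lemma measurable_from_history: "h \<in> measurable (history N X n) S \<Longrightarrow> h \<in> measurable N S"
  using measurable_from_subalg[OF subalg] .

lemma walk_measurable_history: "walk X n \<in> borel_measurable (history N X n)"
  unfolding walk_def[abs_def] by (intro borel_measurable_sum measurable_history) auto

lemma dev_measurable_history [measurable]: "dev n \<in> borel_measurable (history N X n)"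
  unfolding dev_def[abs_def] using walk_measurable_history by measurable

lemma drift_measurable_history [measurable]: "drift n \<in> borel_measurable (history N X n)"
  unfolding drift_def[abs_def] by measurable

lemma X_Suc_measurable [measurable]: "X (Suc n) \<in> borel_measurable N"
  by (simp add: X_measurable)

lemma dev_measurable [measurable]: "dev n \<in> borel_measurable N"
  by (rule measurable_from_history[OF dev_measurable_history])

lemma drift_measurable [measurable]: "drift n \<in> borel_measurable N"
  by (rule measurable_from_history[OF drift_measurable_history])

lemma incr_measurable [measurable]: "incr n \<in> borel_measurable N"
  unfolding incr_def[abs_def] by measurable

lemma walk_measurable: "walk X n \<in> borel_measurable N"
  by (rule measurable_from_history[OF walk_measurable_history])

section \<open>Uniform bounds and integrability\<close>

lemma integrable_bounded:
  fixes h :: "'w \<Rightarrow> 'b :: {banach, second_countable_topology}"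
  assumes "h \<in> borel_measurable N" "\<And>\<omega>. \<omega> \<in> space N \<Longrightarrow> norm (h \<omega>) \<le> B"
  shows "integrable N h"
  using assms by (intro integrable_const_bound[where B = B]) auto

lemma integrable_bounded_sq:
  fixes h :: "'w \<Rightarrow> real"
  assumes "h \<in> borel_measurable N" "\<And>\<omega>. \<omega> \<in> space N \<Longrightarrow> \<bar>h \<omega>\<bar> \<le> B"
  shows "integrable N (\<lambda>\<omega>. (h \<omega>)\<^sup>2)"
proof (rule integrable_bounded[where B = "B\<^sup>2"])
  fix \<omega> assume "\<omega> \<in> space N"
  from power_mono[OF assms(2)[OF this], of 2] show "norm ((h \<omega>)\<^sup>2) \<le> B\<^sup>2" by simp
qed (use assms(1) in simp)

lemma X_abs: "\<omega> \<in> space N \<Longrightarrow> \<bar>X (Suc n) \<omega>\<bar> = 1"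
  using X_range[of "Suc n" \<omega>] by auto

lemma X_integrable: "integrable N (X (Suc n))"
  by (rule integrable_bounded[where B = 1]) (auto simp: X_abs)

lemma expectation_X_abs: "\<bar>expectation (X (Suc n))\<bar> \<le> 1"
proof -
  have "norm (expectation (X (Suc n))) \<le> expectation (\<lambda>\<omega>. norm (X (Suc n) \<omega>))"
    by (rule integral_norm_bound)
  also have "\<dots> = expectation (\<lambda>\<omega>. 1)"
    by (rule Bochner_Integration.integral_cong) (auto simp: X_abs)
  finally show ?thesis by (simp add: prob_space)
qed

lemma walk_Suc: "walk X (Suc n) \<omega> = walk X n \<omega> + X (Suc n) \<omega>"
  by (simp add: walk_def)

lemma walk_abs: "\<omega> \<in> space N \<Longrightarrow> \<bar>walk X n \<omega>\<bar> \<le> real n"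
proof (induction n)
  case (Suc n)
  then show ?case using X_abs[of \<omega> n] by (simp add: walk_Suc)
qed (simp add: walk_def)

lemma walk_integrable: "integrable N (walk X n)"
  by (rule integrable_bounded[where B = n]) (auto simp: walk_abs walk_measurable)

lemma expectation_walk_Suc:
  "expectation (walk X (Suc n)) = expectation (walk X n) + expectation (X (Suc n))"
  unfolding walk_Suc[abs_def]
  by (rule Bochner_Integration.integral_add[OF walk_integrable X_integrable])

lemma expectation_walk_abs: "\<bar>expectation (walk X n)\<bar> \<le> real n"
proof (induction n)
  case (Suc n)
  then show ?case using expectation_X_abs[of n] by (simp add: expectation_walk_Suc)
qed (simp add: walk_def)

lemma dev_abs: "\<omega> \<in> space N \<Longrightarrow> \<bar>dev n \<omega>\<bar> \<le> 2 * real n"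
  using walk_abs[of \<omega> n] expectation_walk_abs[of n] unfolding dev_def by linarith

text \<open>The part of the drift proportional to \<open>dev n\<close> goes into the factor. This is
  the growth factor of \<open>a\<close>, which is why division by \<open>a\<close> will produce a
  martingale.\<close>

lemma dev_Suc: "dev (Suc n) \<omega> = (1 + \<beta> n / real n) * dev n \<omega> + incr n \<omega>"
  by (simp add: dev_def walk_Suc expectation_walk_Suc incr_def drift_def distrib_right)

lemma drift_minus_mean_abs:
  "\<bar>drift n \<omega> - expectation (X (Suc n))\<bar> \<le> \<bar>dev n \<omega>\<bar> / real n"
  using mult_right_mono[OF \<beta>_abs[of n], of "\<bar>dev n \<omega>\<bar>"]
  by (simp add: drift_def abs_mult divide_right_mono)

text \<open>The mean contributes at most 1 and the centred part at most 2. The bound holds at every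
  point, so no almost-everywhere argument is involved.\<close>

lemma drift_abs: "\<omega> \<in> space N \<Longrightarrow> \<bar>drift n \<omega>\<bar> \<le> 3"
proof -
  assume \<omega>: "\<omega> \<in> space N"
  have "\<bar>dev n \<omega>\<bar> / real n \<le> 2"
    using dev_abs[OF \<omega>, of n] by (cases "n = 0") (auto simp: divide_le_eq)
  then show ?thesis
    using drift_minus_mean_abs[of n \<omega>] expectation_X_abs[of n] by linarith
qed

text \<open>Factor the difference of squares; the sum is at most 3 + 1. This is the price of
  replacing the conditional variance by a deterministic one.\<close>

lemma drift_sq_minus_mean_sq_abs:
  assumes "\<omega> \<in> space N"
  shows "\<bar>(drift n \<omega>)\<^sup>2 - (expectation (X (Suc n)))\<^sup>2\<bar> \<le> 4 * (\<bar>dev n \<omega>\<bar> / real n)"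
proof -
  let ?e = "expectation (X (Suc n))"
  have "\<bar>(drift n \<omega>)\<^sup>2 - ?e\<^sup>2\<bar> = \<bar>drift n \<omega> + ?e\<bar> * \<bar>drift n \<omega> - ?e\<bar>"
    by (simp add: power2_eq_square square_diff_square_factored abs_mult)
  also have "\<dots> \<le> 4 * (\<bar>dev n \<omega>\<bar> / real n)"
    using drift_abs[OF assms, of n] expectation_X_abs[of n] drift_minus_mean_abs[of n \<omega>]
    by (intro mult_mono) auto
  finally show ?thesis .
qed

lemma incr_abs: "\<omega> \<in> space N \<Longrightarrow> \<bar>incr n \<omega>\<bar> \<le> 4"
  using X_abs[of \<omega> n] drift_abs[of \<omega> n] by (simp add: incr_def)

text \<open>The martingale difference property in integrated form: \<open>linear_mean\<close> with
  the drift moved to the left. Boundedness of \<open>h\<close> allows the integral to be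
  split.\<close>

lemma expectation_mult_incr:
  fixes h :: "'w \<Rightarrow> real"
  assumes h: "h \<in> borel_measurable (history N X n)"
    and B: "\<And>\<omega>. \<omega> \<in> space N \<Longrightarrow> \<bar>h \<omega>\<bar> \<le> B"
  shows "expectation (\<lambda>\<omega>. h \<omega> * incr n \<omega>) = 0"
proof -
  have [measurable]: "h \<in> borel_measurable N" using h by (rule measurable_from_history)
  have B0: "B \<ge> 0" using not_empty B abs_ge_zero by (metis ex_in_conv order_trans)
  have "integrable N (\<lambda>\<omega>. h \<omega> * X (Suc n) \<omega>)"
    by (rule integrable_bounded[where B = B]) (auto simp: abs_mult X_abs B)
  moreover have "integrable N (\<lambda>\<omega>. h \<omega> * drift n \<omega>)"
    by (rule integrable_bounded[where B = "B * 3"])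
      (use B drift_abs B0 in \<open>auto simp: abs_mult intro!: mult_mono\<close>)
  ultimately show ?thesis
    using linear_mean[OF h B] by (simp add: incr_def right_diff_distrib drift_def dev_def)
qed

text \<open>The step squares to 1. In the last term a function of the past multiplies a martingale
  difference, so conditionally only \<open>1 - (drift n \<omega>)\<^sup>2\<close> survives.\<close>

lemma incr_sq: "\<omega> \<in> space N \<Longrightarrow> (incr n \<omega>)\<^sup>2 = 1 - (drift n \<omega>)\<^sup>2 - 2 * (drift n \<omega> * incr n \<omega>)"
  using X_range[of "Suc n" \<omega>] by (auto simp: incr_def power2_eq_square algebra_simps)

text \<open>After \<open>incr_sq\<close>, the extra term vanishes by
  \<open>expectation_mult_incr\<close> with test function \<open>h\<close> times
  \<open>drift n\<close>.\<close>

lemma expectation_mult_incr_sq: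
  fixes h :: "'w \<Rightarrow> real"
  assumes h: "h \<in> borel_measurable (history N X n)"
    and B: "\<And>\<omega>. \<omega> \<in> space N \<Longrightarrow> \<bar>h \<omega>\<bar> \<le> B"
  shows "expectation (\<lambda>\<omega>. h \<omega> * (incr n \<omega>)\<^sup>2) = expectation (\<lambda>\<omega>. h \<omega> * (1 - (drift n \<omega>)\<^sup>2))"
proof -
  have [measurable]: "h \<in> borel_measurable N" using h by (rule measurable_from_history)
  have B0: "B \<ge> 0" using not_empty B abs_ge_zero by (metis ex_in_conv order_trans)
  have bd: "\<bar>h \<omega> * drift n \<omega>\<bar> \<le> B * 3" if "\<omega> \<in> space N" for \<omega>
    using B[OF that] drift_abs[OF that, of n] B0 by (auto simp: abs_mult intro!: mult_mono)
  have "integrable N (\<lambda>\<omega>. h \<omega> * (1 - (drift n \<omega>)\<^sup>2))"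
  proof (rule integrable_bounded[where B = "B * 10"])
    fix \<omega> assume \<omega>: "\<omega> \<in> space N"
    have "(drift n \<omega>)\<^sup>2 \<le> 9" using power_mono[OF drift_abs[OF \<omega>, of n], of 2] by simp
    then have "\<bar>1 - (drift n \<omega>)\<^sup>2\<bar> \<le> 10" using zero_le_power2[of "drift n \<omega>"] by linarith
    with B[OF \<omega>] B0 show "norm (h \<omega> * (1 - (drift n \<omega>)\<^sup>2)) \<le> B * 10"
      by (auto simp: abs_mult intro!: mult_mono)
  qed simp
  moreover have "integrable N (\<lambda>\<omega>. (h \<omega> * drift n \<omega>) * incr n \<omega>)"
  proof (rule integrable_bounded[where B = "B * 3 * 4"])
    fix \<omega> assume "\<omega> \<in> space N"
    then show "norm ((h \<omega> * drift n \<omega>) * incr n \<omega>) \<le> B * 3 * 4"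
      unfolding real_norm_def abs_mult[of "h \<omega> * drift n \<omega>"]
      using B0 by (intro mult_mono bd incr_abs) auto
  qed simp
  moreover have "expectation (\<lambda>\<omega>. (h \<omega> * drift n \<omega>) * incr n \<omega>) = 0"
    by (rule expectation_mult_incr[OF _ bd]) (use h in measurable)
  moreover have "expectation (\<lambda>\<omega>. h \<omega> * (incr n \<omega>)\<^sup>2) =
      expectation (\<lambda>\<omega>. h \<omega> * (1 - (drift n \<omega>)\<^sup>2) - 2 * ((h \<omega> * drift n \<omega>) * incr n \<omega>))"
    by (rule Bochner_Integration.integral_cong) (auto simp: incr_sq algebra_simps)
  ultimately show ?thesis by simp
qed

text \<open>Real and imaginary parts inherit the bound on \<open>h\<close>, so identities for real
  test functions extend to the complex exponentials of characteristic functions.\<close>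

lemma complex_expectation_mult_eqI:
  fixes h :: "'w \<Rightarrow> complex" and u w :: "'w \<Rightarrow> real"
  assumes h: "h \<in> borel_measurable (history N X n)"
    and B: "\<And>\<omega>. \<omega> \<in> space N \<Longrightarrow> cmod (h \<omega>) \<le> B"
    and int: "integrable N (\<lambda>\<omega>. h \<omega> * of_real (u \<omega>))" "integrable N (\<lambda>\<omega>. h \<omega> * of_real (w \<omega>))"
    and eq: "\<And>k :: 'w \<Rightarrow> real. k \<in> borel_measurable (history N X n) \<Longrightarrow>
      (\<And>\<omega>. \<omega> \<in> space N \<Longrightarrow> \<bar>k \<omega>\<bar> \<le> B) \<Longrightarrow>
      expectation (\<lambda>\<omega>. k \<omega> * u \<omega>) = expectation (\<lambda>\<omega>. k \<omega> * w \<omega>)"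
  shows "expectation (\<lambda>\<omega>. h \<omega> * of_real (u \<omega>)) = expectation (\<lambda>\<omega>. h \<omega> * of_real (w \<omega>))"
proof (rule complex_eqI)
  have "Re (expectation (\<lambda>\<omega>. h \<omega> * of_real (u \<omega>))) = expectation (\<lambda>\<omega>. Re (h \<omega>) * u \<omega>)"
    using int(1) by (simp flip: integral_Re)
  also have "\<dots> = expectation (\<lambda>\<omega>. Re (h \<omega>) * w \<omega>)"
    by (rule eq) (use h B in \<open>auto intro: order_trans[OF abs_Re_le_cmod]\<close>)
  also have "\<dots> = Re (expectation (\<lambda>\<omega>. h \<omega> * of_real (w \<omega>)))"
    using int(2) by (simp flip: integral_Re)
  finally show "Re (expectation (\<lambda>\<omega>. h \<omega> * of_real (u \<omega>))) =
      Re (expectation (\<lambda>\<omega>. h \<omega> * of_real (w \<omega>)))" .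
  have "Im (expectation (\<lambda>\<omega>. h \<omega> * of_real (u \<omega>))) = expectation (\<lambda>\<omega>. Im (h \<omega>) * u \<omega>)"
    using int(1) by (simp flip: integral_Im)
  also have "\<dots> = expectation (\<lambda>\<omega>. Im (h \<omega>) * w \<omega>)"
    by (rule eq) (use h B in \<open>auto intro: order_trans[OF abs_Im_le_cmod]\<close>)
  also have "\<dots> = Im (expectation (\<lambda>\<omega>. h \<omega> * of_real (w \<omega>)))"
    using int(2) by (simp flip: integral_Im)
  finally show "Im (expectation (\<lambda>\<omega>. h \<omega> * of_real (u \<omega>))) =
      Im (expectation (\<lambda>\<omega>. h \<omega> * of_real (w \<omega>)))" .
qed

text \<open>Squaring \<open>dev_Suc\<close> leaves a cross term that vanishes by orthogonality, and
  the increment has second moment at most 1.\<close>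

lemma second_moment_dev_Suc:
  "expectation (\<lambda>\<omega>. (dev (Suc n) \<omega>)\<^sup>2) \<le>
     (1 + \<beta> n / real n)\<^sup>2 * expectation (\<lambda>\<omega>. (dev n \<omega>)\<^sup>2) + 1"
proof -
  let ?r = "1 + \<beta> n / real n"
  have i1: "integrable N (\<lambda>\<omega>. (dev n \<omega>)\<^sup>2)"
    by (rule integrable_bounded_sq[OF _ dev_abs]) simp
  have i2: "integrable N (\<lambda>\<omega>. dev n \<omega> * incr n \<omega>)"
  proof (rule integrable_bounded[where B = "2 * real n * 4"])
    fix \<omega> assume "\<omega> \<in> space N"
    then show "norm (dev n \<omega> * incr n \<omega>) \<le> 2 * real n * 4"
      unfolding real_norm_def abs_mult by (intro mult_mono dev_abs incr_abs) auto
  qed simp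
  have i3: "integrable N (\<lambda>\<omega>. (incr n \<omega>)\<^sup>2)"
    by (rule integrable_bounded_sq[OF _ incr_abs]) simp
  have i4: "integrable N (\<lambda>\<omega>. (drift n \<omega>)\<^sup>2)"
    by (rule integrable_bounded_sq[OF _ drift_abs]) simp
  have "expectation (\<lambda>\<omega>. dev n \<omega> * incr n \<omega>) = 0"
    by (rule expectation_mult_incr[OF dev_measurable_history dev_abs])
  moreover have "expectation (\<lambda>\<omega>. (incr n \<omega>)\<^sup>2) \<le> 1"
  proof -
    have "expectation (\<lambda>\<omega>. (incr n \<omega>)\<^sup>2) = expectation (\<lambda>\<omega>. 1 - (drift n \<omega>)\<^sup>2)"
      using expectation_mult_incr_sq[of "\<lambda>_. 1" n 1] by simp
    also have "\<dots> = 1 - expectation (\<lambda>\<omega>. (drift n \<omega>)\<^sup>2)" using i4 by (simp add: prob_space)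
    also have "\<dots> \<le> 1" by simp
    finally show ?thesis .
  qed
  moreover have "(dev (Suc n) \<omega>)\<^sup>2 =
      ?r\<^sup>2 * (dev n \<omega>)\<^sup>2 + 2 * ?r * (dev n \<omega> * incr n \<omega>) + (incr n \<omega>)\<^sup>2" for \<omega>
  proof -
    have "(r * d + i)\<^sup>2 = r\<^sup>2 * d\<^sup>2 + 2 * r * (d * i) + i\<^sup>2" for r d i :: real
      by (simp add: power2_eq_square algebra_simps)
    then show ?thesis unfolding dev_Suc .
  qed
  ultimately show ?thesis using i1 i2 i3 by simp
qed

text \<open>Nonnegativity of the variance of \<open>\<bar>dev n \<omega>\<bar>\<close>.\<close>

lemma expectation_abs_dev: "expectation (\<lambda>\<omega>. \<bar>dev n \<omega>\<bar>) \<le> sqrt (expectation (\<lambda>\<omega>. (dev n \<omega>)\<^sup>2))"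
proof (rule real_le_rsqrt)
  have i1: "integrable N (\<lambda>\<omega>. (dev n \<omega>)\<^sup>2)"
    by (rule integrable_bounded_sq[OF _ dev_abs]) simp
  have i2: "integrable N (\<lambda>\<omega>. \<bar>dev n \<omega>\<bar>)"
    by (rule integrable_bounded[where B = "2 * real n"]) (use dev_abs in auto)
  show "(expectation (\<lambda>\<omega>. \<bar>dev n \<omega>\<bar>))\<^sup>2 \<le> expectation (\<lambda>\<omega>. (dev n \<omega>)\<^sup>2)"
    using variance_positive[of "\<lambda>\<omega>. \<bar>dev n \<omega>\<bar>"] variance_eq[OF i2] i1 by simp
qed

end

section \<open>Characteristic functions\<close>

locale linear_walk_clt = linear_walk N \<beta> X + growth \<beta> a
  for N :: "'w measure" and \<beta> a :: "nat \<Rightarrow> real" and X :: "nat \<Rightarrow> 'w \<Rightarrow> real" +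
  fixes \<epsilon> :: real
  assumes eps_pos: "0 < \<epsilon>"
    and variance_lower:
      "\<forall>\<^sub>F k in sequentially. \<epsilon> \<le> 1 - (expectation (X (Suc k)))\<^sup>2"
begin

text \<open>The conditional variance of the martingale increment with the conditional mean replaced
  by the expectation.\<close>

definition s :: "nat \<Rightarrow> real" where
  "s k = (1 - (expectation (X (Suc k)))\<^sup>2) / (a (Suc k))\<^sup>2"

lemma mean_sq_le_1: "(expectation (X (Suc k)))\<^sup>2 \<le> 1"
  using power_mono[OF expectation_X_abs[of k], of 2] by simp

lemma s_le: "s k \<le> 1 / (a (Suc k))\<^sup>2"
  unfolding s_def by (rule divide_right_mono) auto

sublocale growth_variance \<beta> a s \<epsilon>
proof
  show "0 \<le> s k" for k using mean_sq_le_1[of k] by (simp add: s_def)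
  show "\<forall>\<^sub>F k in sequentially. \<epsilon> / (a (Suc k))\<^sup>2 \<le> s k"
    using variance_lower by eventually_elim (auto simp: s_def intro!: divide_right_mono)
qed (rule eps_pos)

definition mart :: "nat \<Rightarrow> 'w \<Rightarrow> real" where
  "mart n \<omega> = dev n \<omega> / a n"

lemma mart_measurable_history [measurable]: "mart n \<in> borel_measurable (history N X n)"
  unfolding mart_def[abs_def] by measurable

lemma mart_measurable [measurable]: "mart n \<in> borel_measurable N"
  by (rule measurable_from_history[OF mart_measurable_history])

lemma mart_Suc: "mart (Suc n) \<omega> = mart n \<omega> + incr n \<omega> / a (Suc n)"
proof -
  have "1 + \<beta> n / real n \<noteq> 0" using a_pos[of "Suc n"] a_Suc[of n] by auto
  then show ?thesis
    using a_pos[of n] by (simp add: mart_def dev_Suc a_Suc add_divide_distrib)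
qed

text \<open>With c = \<theta> / \<open>a (Suc k)\<close> the terms are the cubic Taylor remainder
  for an increment of size at most 4 (4^3/6 = 32/3), the replacement of the conditional variance (4
  c^2/2 times the mean deviation), and the remainder of the Gaussian factor ((c^2/2)^2/2). The
  factor \<open>(1 / a (Suc k))\<^sup>2\<close> is pulled out for comparison with
  \<open>s k\<close>.\<close>

definition step_error :: "real \<Rightarrow> nat \<Rightarrow> real" where
  "step_error \<theta> k = (1 / a (Suc k))\<^sup>2 * (32 / 3 * \<bar>\<theta>\<bar> ^ 3 * (1 / a (Suc k)) +
     2 * \<theta>\<^sup>2 * (expectation (\<lambda>\<omega>. \<bar>dev k \<omega>\<bar>) / real k) + \<theta> ^ 4 / 8 * (1 / a (Suc k))\<^sup>2)"

lemma iexp_quadratic: "cmod (iexp x - (1 + \<i> * x - x\<^sup>2 / 2)) \<le> \<bar>x\<bar> ^ 3 / 6"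
  using iexp_approx1[of x 2]
  by (simp add: numeral_eq_Suc atMost_Suc fact_reduce algebra_simps)

text \<open>Expand the exponential of the new increment to second order against the past factor
  \<open>h\<close>. The linear term has mean zero and the quadratic one reduces to the conditional
  variance; what remains is compared with the Gaussian factor.\<close>

lemma char_step:
  "cmod (expectation (\<lambda>\<omega>. iexp (\<theta> * mart (Suc n) \<omega>)) -
     exp (- (\<theta>\<^sup>2 * s n / 2)) * expectation (\<lambda>\<omega>. iexp (\<theta> * mart n \<omega>))) \<le> step_error \<theta> n"
proof -
  define c where "c = \<theta> / a (Suc n)"
  define \<rho> where "\<rho> = exp (- (\<theta>\<^sup>2 * s n / 2))"
  define h where "h = (\<lambda>\<omega>. iexp (\<theta> * mart n \<omega>))"
  define z where "z = (\<lambda>\<omega>. h \<omega> * (iexp (c * incr n \<omega>) -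
    (1 + \<i> * (c * incr n \<omega>) - (c * incr n \<omega>)\<^sup>2 / 2)))"
  \<comment> \<open>The conditional second-order factor minus the Gaussian factor
    \<open>\<rho>\<close>.\<close>
  define w where "w = (\<lambda>\<omega>. 1 - \<rho> - c\<^sup>2 / 2 * (1 - (drift n \<omega>)\<^sup>2))"
  have h_hist: "h \<in> borel_measurable (history N X n)"
    unfolding h_def by measurable
  have h_meas [measurable]: "h \<in> borel_measurable N"
    using h_hist by (rule measurable_from_history)
  have h_norm: "cmod (h \<omega>) = 1" for \<omega>
    by (simp add: h_def)
  have int_h: "integrable N (\<lambda>\<omega>. h \<omega> * of_real (u \<omega>))"
    if "u \<in> borel_measurable N" "\<And>\<omega>. \<omega> \<in> space N \<Longrightarrow> \<bar>u \<omega>\<bar> \<le> B" for u B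
    using that by (intro integrable_bounded[where B = B]) (auto simp: norm_mult h_norm)
  have drift_sq: "\<bar>(drift n \<omega>)\<^sup>2\<bar> \<le> 9" and incr_sq_le: "\<bar>(incr n \<omega>)\<^sup>2\<bar> \<le> 16" if "\<omega> \<in> space N" for \<omega>
    using power_mono[OF drift_abs[OF that, of n], of 2] power_mono[OF incr_abs[OF that, of n], of 2]
    by simp_all
  have int1: "integrable N (\<lambda>\<omega>. h \<omega> * of_real (incr n \<omega>))"
    by (rule int_h[OF _ incr_abs]) simp
  have int2: "integrable N (\<lambda>\<omega>. h \<omega> * of_real ((incr n \<omega>)\<^sup>2))"
    by (rule int_h[OF _ incr_sq_le]) simp
  have int3: "integrable N (\<lambda>\<omega>. h \<omega> * of_real (1 - (drift n \<omega>)\<^sup>2))"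
  proof (rule int_h[of _ 10])
    show "\<bar>1 - (drift n \<omega>)\<^sup>2\<bar> \<le> 10" if "\<omega> \<in> space N" for \<omega>
      using drift_sq[OF that] by linarith
  qed simp
  define v where "v = (\<lambda>\<omega>. h \<omega> * of_real (1 - (drift n \<omega>)\<^sup>2))"
  have int_v: "integrable N v" using int3 by (simp only: v_def)
  have int0: "integrable N h"
    by (rule integrable_bounded[where B = 1]) (auto simp: h_norm)
  have hw: "h \<omega> * of_real (w \<omega>) = of_real (1 - \<rho>) * h \<omega> - of_real (c\<^sup>2 / 2) * v \<omega>" for \<omega>
    by (simp add: w_def v_def algebra_simps)
  have int_w: "integrable N (\<lambda>\<omega>. h \<omega> * of_real (w \<omega>))"
  proof -
    have "integrable N (\<lambda>\<omega>. of_real (1 - \<rho>) * h \<omega> - of_real (c\<^sup>2 / 2) * v \<omega>)"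
      using int0 int_v by simp
    then show ?thesis unfolding hw .
  qed
  have z_norm: "cmod (z \<omega>) \<le> 32 / 3 * \<bar>c\<bar> ^ 3" if \<omega>: "\<omega> \<in> space N" for \<omega>
  proof -
    have "cmod (z \<omega>) \<le> \<bar>c * incr n \<omega>\<bar> ^ 3 / 6"
      unfolding z_def norm_mult h_norm mult_1_left
      using iexp_quadratic[of "c * incr n \<omega>"] by simp
    also have "\<dots> \<le> (\<bar>c\<bar> * 4) ^ 3 / 6"
      using incr_abs[OF \<omega>, of n]
      by (intro divide_right_mono power_mono) (auto simp: abs_mult intro!: mult_left_mono)
    finally show ?thesis by (simp add: power_mult_distrib)
  qed
  have int_z: "integrable N z"
    using z_norm unfolding z_def by (intro integrable_bounded) measurable
  have "expectation (\<lambda>\<omega>. h \<omega> * of_real (incr n \<omega>)) = expectation (\<lambda>\<omega>. h \<omega> * of_real 0)"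
  proof (rule complex_expectation_mult_eqI[OF h_hist _ int1, of 1])
    fix k :: "'w \<Rightarrow> real"
    assume "k \<in> borel_measurable (history N X n)" "\<And>\<omega>. \<omega> \<in> space N \<Longrightarrow> \<bar>k \<omega>\<bar> \<le> 1"
    then have "expectation (\<lambda>\<omega>. k \<omega> * incr n \<omega>) = 0" by (rule expectation_mult_incr)
    then show "expectation (\<lambda>\<omega>. k \<omega> * incr n \<omega>) = expectation (\<lambda>\<omega>. k \<omega> * 0)" by simp
  qed (simp_all add: h_norm)
  then have mean: "expectation (\<lambda>\<omega>. h \<omega> * of_real (incr n \<omega>)) = 0" by simp
  have var: "expectation (\<lambda>\<omega>. h \<omega> * of_real ((incr n \<omega>)\<^sup>2)) =
      expectation v"
    unfolding v_def
  proof (rule complex_expectation_mult_eqI[OF h_hist _ int2 int3, of 1])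
    fix k :: "'w \<Rightarrow> real"
    assume "k \<in> borel_measurable (history N X n)" "\<And>\<omega>. \<omega> \<in> space N \<Longrightarrow> \<bar>k \<omega>\<bar> \<le> 1"
    then show "expectation (\<lambda>\<omega>. k \<omega> * (incr n \<omega>)\<^sup>2) =
        expectation (\<lambda>\<omega>. k \<omega> * (1 - (drift n \<omega>)\<^sup>2))"
      by (rule expectation_mult_incr_sq)
  qed (simp_all add: h_norm)
  have "iexp (\<theta> * mart (Suc n) \<omega>) =
      z \<omega> + h \<omega> + \<i> * c * (h \<omega> * of_real (incr n \<omega>)) - c\<^sup>2 / 2 * (h \<omega> * of_real ((incr n \<omega>)\<^sup>2))" for \<omega>
  proof -
    have "iexp (\<theta> * mart (Suc n) \<omega>) = h \<omega> * iexp (c * incr n \<omega>)"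
    proof -
      have "\<theta> * mart (Suc n) \<omega> = \<theta> * mart n \<omega> + c * incr n \<omega>"
        by (simp add: mart_Suc c_def distrib_left)
      then show ?thesis by (simp only: h_def of_real_add distrib_left exp_add)
    qed
    moreover have "h' * E = h' * (E - (1 + \<i> * (c' * x) - (c' * x)\<^sup>2 / 2)) + h' +
        \<i> * c' * (h' * x) - c'\<^sup>2 / 2 * (h' * x\<^sup>2)" for h' E c' x :: complex
      by (simp add: algebra_simps power2_eq_square)
    ultimately show ?thesis
      unfolding z_def by (simp only: of_real_mult of_real_power of_real_divide of_real_numeral)
  qed
  then have "expectation (\<lambda>\<omega>. iexp (\<theta> * mart (Suc n) \<omega>)) =
      expectation z + expectation h - c\<^sup>2 / 2 * expectation v"
    using int_z int0 int1 int2 mean var by simp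
  moreover have "expectation (\<lambda>\<omega>. h \<omega> * of_real (w \<omega>)) =
      of_real (1 - \<rho>) * expectation h - of_real (c\<^sup>2 / 2) * expectation v"
    unfolding hw using int0 int_v by simp
  ultimately have split: "expectation (\<lambda>\<omega>. iexp (\<theta> * mart (Suc n) \<omega>)) - \<rho> * expectation h =
      expectation z + expectation (\<lambda>\<omega>. h \<omega> * of_real (w \<omega>))"
    by (simp only:) (simp add: algebra_simps)
  have "cmod (expectation z) \<le> expectation (\<lambda>\<omega>. cmod (z \<omega>))"
    by (rule integral_norm_bound)
  also have "\<dots> \<le> expectation (\<lambda>\<omega>. 32 / 3 * \<bar>c\<bar> ^ 3)"
    using z_norm int_z by (intro integral_mono) auto
  finally have bound_z: "cmod (expectation z) \<le> 32 / 3 * \<bar>c\<bar> ^ 3"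
    by (simp add: prob_space)
  have int_dev: "integrable N (\<lambda>\<omega>. \<bar>dev n \<omega>\<bar>)"
    by (rule integrable_bounded[where B = "2 * real n"]) (use dev_abs in auto)
  have w_abs: "\<bar>w \<omega>\<bar> \<le> c ^ 4 / 8 + 2 * c\<^sup>2 * (\<bar>dev n \<omega>\<bar> / real n)" if \<omega>: "\<omega> \<in> space N" for \<omega>
  proof -
    let ?e = "expectation (X (Suc n))"
    have u: "\<theta>\<^sup>2 * s n / 2 = c\<^sup>2 / 2 * (1 - ?e\<^sup>2)"
      by (simp add: s_def c_def power_divide)
    have "0 \<le> c\<^sup>2 / 2 * (1 - ?e\<^sup>2)" using mean_sq_le_1[of n] by simp
    then have "\<bar>1 - \<rho> - c\<^sup>2 / 2 * (1 - ?e\<^sup>2)\<bar> \<le> (c\<^sup>2 / 2 * (1 - ?e\<^sup>2))\<^sup>2 / 2"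
      unfolding \<rho>_def u by (rule exp_minus_quadratic)
    also have "\<dots> \<le> (c\<^sup>2 / 2)\<^sup>2 / 2"
      using mean_sq_le_1[of n] by (intro divide_right_mono power_mono mult_left_le) auto
    also have "\<dots> = c ^ 4 / 8" by (simp add: power_divide)
    finally have 1: "\<bar>1 - \<rho> - c\<^sup>2 / 2 * (1 - ?e\<^sup>2)\<bar> \<le> c ^ 4 / 8" .
    \<comment> \<open>Separates the quadratic remainder of the Gaussian factor from the fluctuation
      of the conditional variance.\<close>
    have "w \<omega> = (1 - \<rho> - c\<^sup>2 / 2 * (1 - ?e\<^sup>2)) + c\<^sup>2 / 2 * ((drift n \<omega>)\<^sup>2 - ?e\<^sup>2)"
      by (simp add: w_def algebra_simps)
    moreover have "\<bar>c\<^sup>2 / 2 * ((drift n \<omega>)\<^sup>2 - ?e\<^sup>2)\<bar> \<le> c\<^sup>2 / 2 * (4 * (\<bar>dev n \<omega>\<bar> / real n))"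
      using drift_sq_minus_mean_sq_abs[OF \<omega>, of n] unfolding abs_mult
      by (intro mult_mono) auto
    ultimately have "\<bar>w \<omega>\<bar> \<le> c ^ 4 / 8 + c\<^sup>2 / 2 * (4 * (\<bar>dev n \<omega>\<bar> / real n))"
      using 1 by linarith
    then show ?thesis by (simp add: mult_ac)
  qed
  have "cmod (expectation (\<lambda>\<omega>. h \<omega> * of_real (w \<omega>))) \<le> expectation (\<lambda>\<omega>. cmod (h \<omega> * of_real (w \<omega>)))"
    by (rule integral_norm_bound)
  also have "\<dots> \<le> expectation (\<lambda>\<omega>. c ^ 4 / 8 + 2 * c\<^sup>2 * (\<bar>dev n \<omega>\<bar> / real n))"
  proof (rule integral_mono)
    show "integrable N (\<lambda>\<omega>. cmod (h \<omega> * of_real (w \<omega>)))"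
      using int_w by (rule integrable_norm)
  qed (use int_dev w_abs in \<open>auto simp: norm_mult h_norm\<close>)
  also have "\<dots> = c ^ 4 / 8 + 2 * c\<^sup>2 * (expectation (\<lambda>\<omega>. \<bar>dev n \<omega>\<bar>) / real n)"
    using int_dev by (simp add: prob_space)
  finally have bound_w: "cmod (expectation (\<lambda>\<omega>. h \<omega> * of_real (w \<omega>))) \<le>
      c ^ 4 / 8 + 2 * c\<^sup>2 * (expectation (\<lambda>\<omega>. \<bar>dev n \<omega>\<bar>) / real n)" .
  have "step_error \<theta> n = 32 / 3 * \<bar>c\<bar> ^ 3 +
      (c ^ 4 / 8 + 2 * c\<^sup>2 * (expectation (\<lambda>\<omega>. \<bar>dev n \<omega>\<bar>) / real n))"
  proof -
    have "x\<^sup>2 * (32 / 3 * \<bar>\<theta>\<bar> ^ 3 * x + 2 * \<theta>\<^sup>2 * D + \<theta> ^ 4 / 8 * x\<^sup>2) =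
        32 / 3 * \<bar>\<theta> * x\<bar> ^ 3 + ((\<theta> * x) ^ 4 / 8 + 2 * (\<theta> * x)\<^sup>2 * D)" if "x > 0" for x D :: real
      using that by (simp add: abs_mult power2_eq_square power3_eq_cube power4_eq_xxxx algebra_simps)
    from this[of "1 / a (Suc n)" "expectation (\<lambda>\<omega>. \<bar>dev n \<omega>\<bar>) / real n"] show ?thesis
      using a_pos[of "Suc n"] by (simp add: step_error_def c_def)
  qed
  with norm_triangle_mono[OF bound_z bound_w] split show ?thesis
    by (simp add: \<rho>_def h_def)
qed

text \<open>Induction from \<open>mart 0 = 0\<close>: the Gaussian factor of each step is at most 1,
  so earlier errors are not amplified and the step errors merely add up.\<close>

lemma char_mart:
  "cmod (expectation (\<lambda>\<omega>. iexp (\<theta> * mart n \<omega>)) - exp (- (\<theta>\<^sup>2 * (\<Sum>k<n. s k) / 2))) \<le>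
     (\<Sum>k<n. step_error \<theta> k)"
proof (induction n)
  case 0
  have "walk X 0 = (\<lambda>_. 0)" by (simp add: walk_def fun_eq_iff)
  then have "mart 0 \<omega> = 0" for \<omega> by (simp add: mart_def dev_def)
  then show ?case by (simp add: prob_space)
next
  case (Suc n)
  let ?\<phi> = "\<lambda>n. expectation (\<lambda>\<omega>. iexp (\<theta> * mart n \<omega>))"
  let ?g = "\<lambda>n. exp (- (\<theta>\<^sup>2 * (\<Sum>k<n. s k) / 2))"
  let ?\<rho> = "exp (- (\<theta>\<^sup>2 * s n / 2))"
  have g: "?g (Suc n) = ?\<rho> * ?g n"
    by (simp add: algebra_simps add_divide_distrib flip: exp_add)
  have eq: "?\<phi> (Suc n) - ?g (Suc n) = (?\<phi> (Suc n) - ?\<rho> * ?\<phi> n) + ?\<rho> * (?\<phi> n - ?g n)"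
    unfolding g by (simp add: algebra_simps)
  have "cmod (?\<phi> (Suc n) - ?g (Suc n)) \<le> step_error \<theta> n + 1 * (\<Sum>k<n. step_error \<theta> k)"
    unfolding eq
  proof (intro norm_triangle_mono char_step)
    have "\<bar>?\<rho>\<bar> \<le> 1" using s_nonneg[of n] by simp
    then show "cmod (?\<rho> * (?\<phi> n - ?g n)) \<le> 1 * (\<Sum>k<n. step_error \<theta> k)"
      unfolding norm_mult norm_of_real using Suc.IH by (intro mult_mono) auto
  qed
  then show ?case unfolding sum.lessThan_Suc[of "step_error \<theta>"] by linarith
qed

text \<open>The first moment is controlled by the square root of the second, which is o(k^2) by
  \<open>second_moment_sublinear\<close>.\<close>

lemma mean_abs_dev_tendsto: "(\<lambda>k. expectation (\<lambda>\<omega>. \<bar>dev k \<omega>\<bar>) / real k) \<longlonglongrightarrow> 0"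
proof (rule tendsto_sandwich[OF _ _ tendsto_const])
  have "(\<lambda>k. expectation (\<lambda>\<omega>. (dev k \<omega>)\<^sup>2) / (real k)\<^sup>2) \<longlonglongrightarrow> 0"
    by (rule second_moment_sublinear[OF _ second_moment_dev_Suc]) simp
  from tendsto_real_sqrt[OF this]
  show "(\<lambda>k. sqrt (expectation (\<lambda>\<omega>. (dev k \<omega>)\<^sup>2)) / real k) \<longlonglongrightarrow> 0"
    by (simp add: real_sqrt_divide)
  show "\<forall>\<^sub>F k in sequentially. expectation (\<lambda>\<omega>. \<bar>dev k \<omega>\<bar>) / real k \<le>
      sqrt (expectation (\<lambda>\<omega>. (dev k \<omega>)\<^sup>2)) / real k"
    by (intro always_eventually allI divide_right_mono expectation_abs_dev) simp
qed simp

text \<open>The scale of a normalised increment, taken with the normalisation at its own time so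
  that it depends on \<open>k\<close> alone. The truncation at 1 avoids small denominators and does
  not affect the limit.\<close>

definition jump :: "nat \<Rightarrow> real" where
  "jump k = sqrt (1 / (a (Suc k))\<^sup>2 / max 1 (\<Sum>j<Suc k. s j))"

lemma jump_tendsto: "jump \<longlonglongrightarrow> 0"
proof -
  have "\<forall>\<^sub>F k in sequentially. 1 \<le> (\<Sum>j<Suc k. s j)"
    using sum_s_at_top unfolding filterlim_at_top by (subst eventually_sequentially_Suc) blast
  then have "\<forall>\<^sub>F k in sequentially.
      1 / (a (Suc k))\<^sup>2 / (\<Sum>j<Suc k. s j) = 1 / (a (Suc k))\<^sup>2 / max 1 (\<Sum>j<Suc k. s j)"
    by eventually_elim (simp add: max_def)
  with smalloD_tendsto[OF inverse_sq_smallo_sum]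
  have "(\<lambda>k. 1 / (a (Suc k))\<^sup>2 / max 1 (\<Sum>j<Suc k. s j)) \<longlonglongrightarrow> 0"
    by (rule Lim_transform_eventually)
  from tendsto_real_sqrt[OF this] show ?thesis
    unfolding jump_def[abs_def] by simp
qed

text \<open>The partial sums of \<open>s\<close> are nondecreasing and the last is at least 1, so
  the normalised scale is at most \<open>jump k\<close>. The index \<open>n\<close> then enters the
  bound only through the final division, which makes the total error a weighted average.\<close>

lemma step_error_le:
  fixes t :: real
  defines "A \<equiv> \<lambda>n. sqrt (\<Sum>k<n. s k)"
  assumes "k < n" "1 \<le> (\<Sum>k<n. s k)"
  shows "step_error (t / A n) k \<le> 1 / (a (Suc k))\<^sup>2 * (32 / 3 * \<bar>t\<bar> ^ 3 * jump k +
     2 * t\<^sup>2 * (expectation (\<lambda>\<omega>. \<bar>dev k \<omega>\<bar>) / real k) + t ^ 4 / 8 * (jump k)\<^sup>2) / (\<Sum>k<n. s k)"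
proof -
  define j where "j = 1 / (a (Suc k) * A n)"
  have A: "A n > 0" "(A n)\<^sup>2 = (\<Sum>k<n. s k)" using assms(3) by (auto simp: A_def)
  have a: "a (Suc k) > 0" by (rule a_pos)
  have "(\<Sum>j<Suc k. s j) \<le> (\<Sum>j<n. s j)"
    using assms(2) by (intro sum_mono2) (auto simp: s_nonneg)
  then have "1 / (a (Suc k))\<^sup>2 / (\<Sum>j<n. s j) \<le> 1 / (a (Suc k))\<^sup>2 / max 1 (\<Sum>j<Suc k. s j)"
    using assms(3) by (intro divide_left_mono) auto
  moreover have "j = sqrt (1 / (a (Suc k))\<^sup>2 / (\<Sum>j<n. s j))"
    using a by (simp add: j_def A_def real_sqrt_divide real_sqrt_mult)
  ultimately have j_le: "j \<le> jump k"
    unfolding jump_def by (simp only: real_sqrt_le_iff)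
  have j: "0 \<le> j" using a A by (simp add: j_def)
  let ?D = "expectation (\<lambda>\<omega>. \<bar>dev k \<omega>\<bar>) / real k"
  have "step_error (t / A n) k =
      1 / (a (Suc k))\<^sup>2 * (32 / 3 * \<bar>t\<bar> ^ 3 * j + 2 * t\<^sup>2 * ?D + t ^ 4 / 8 * j\<^sup>2) / (A n)\<^sup>2"
  proof -
    have "x\<^sup>2 * (32 / 3 * \<bar>t * u\<bar> ^ 3 * x + 2 * (t * u)\<^sup>2 * D + (t * u) ^ 4 / 8 * x\<^sup>2) =
        x\<^sup>2 * (32 / 3 * \<bar>t\<bar> ^ 3 * (x * u) + 2 * t\<^sup>2 * D + t ^ 4 / 8 * (x * u)\<^sup>2) * u\<^sup>2"
      if "u > 0" for x u D :: real
      using that by (simp add: abs_mult power2_eq_square power3_eq_cube power4_eq_xxxx algebra_simps)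
    from this[of "1 / A n" "1 / a (Suc k)" ?D] show ?thesis
      using A by (simp add: step_error_def j_def power_one_over)
  qed
  also have "\<dots> \<le> 1 / (a (Suc k))\<^sup>2 * (32 / 3 * \<bar>t\<bar> ^ 3 * jump k + 2 * t\<^sup>2 * ?D + t ^ 4 / 8 * (jump k)\<^sup>2) / (A n)\<^sup>2"
    using j j_le by (intro divide_right_mono mult_left_mono add_mono power_mono) auto
  finally show ?thesis using A by simp
qed

text \<open>By Levy continuity it suffices to apply \<open>char_mart\<close> at frequency
  \<open>t\<close> divided by the square root of the variance sum. The errors are o(s) termwise,
  hence o of the sum of \<open>s\<close> in total.\<close>

theorem central_limit:
  "weak_conv_m (\<lambda>n. distr N borel (\<lambda>\<omega>. dev n \<omega> / (a n * sqrt (\<Sum>k<n. s k)))) std_normal_distribution"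
proof (rule levy_continuity)
  show "real_distribution (distr N borel (\<lambda>\<omega>. dev n \<omega> / (a n * sqrt (\<Sum>k<n. s k))))" for n
    by (rule real_distribution_distr) measurable
  show "real_distribution std_normal_distribution"
    by (rule real_dist_normal_dist)
  fix t :: real
  define y where "y = (\<lambda>k. 1 / (a (Suc k))\<^sup>2 * (32 / 3 * \<bar>t\<bar> ^ 3 * jump k +
     2 * t\<^sup>2 * (expectation (\<lambda>\<omega>. \<bar>dev k \<omega>\<bar>) / real k) + t ^ 4 / 8 * (jump k)\<^sup>2))"
  have "(\<lambda>k. 32 / 3 * \<bar>t\<bar> ^ 3 * jump k +
     2 * t\<^sup>2 * (expectation (\<lambda>\<omega>. \<bar>dev k \<omega>\<bar>) / real k) + t ^ 4 / 8 * (jump k)\<^sup>2)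
     \<longlonglongrightarrow> 32 / 3 * \<bar>t\<bar> ^ 3 * 0 + 2 * t\<^sup>2 * 0 + t ^ 4 / 8 * 0\<^sup>2"
    by (intro tendsto_intros jump_tendsto mean_abs_dev_tendsto)
  then have "y \<in> o(\<lambda>k. s k * 1)"
    unfolding y_def by (intro landau_o.big_small_mult inverse_sq_bigo smalloI_tendsto) auto
  then have "(\<lambda>n. \<Sum>k<n. y k) \<in> o(\<lambda>n. \<Sum>k<n. s k)"
    by (intro sum_smallo s_nonneg sum_s_at_top) simp
  then have lim: "(\<lambda>n. (\<Sum>k<n. y k) / (\<Sum>k<n. s k)) \<longlonglongrightarrow> 0"
    by (rule smalloD_tendsto)
  have ev: "\<forall>\<^sub>F n in sequentially. 1 \<le> (\<Sum>k<n. s k)"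
    using sum_s_at_top by (auto simp: filterlim_at_top)
  show "(\<lambda>n. char (distr N borel (\<lambda>\<omega>. dev n \<omega> / (a n * sqrt (\<Sum>k<n. s k)))) t)
      \<longlonglongrightarrow> char std_normal_distribution t"
    unfolding char_std_normal_distribution
  proof (rule Lim_transform_bound[THEN LIM_zero_cancel, rotated])
    show "(\<lambda>n. (\<Sum>k<n. y k) / (\<Sum>k<n. s k)) \<longlonglongrightarrow> 0" by (rule lim)
    show "\<forall>\<^sub>F n in sequentially.
      norm (char (distr N borel (\<lambda>\<omega>. dev n \<omega> / (a n * sqrt (\<Sum>k<n. s k)))) t - of_real (exp (- t\<^sup>2 / 2)))
        \<le> norm ((\<Sum>k<n. y k) / (\<Sum>k<n. s k))"
      using ev
    proof eventually_elim
      case (elim n)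
      define A where "A = sqrt (\<Sum>k<n. s k)"
      have A: "A > 0" "A\<^sup>2 = (\<Sum>k<n. s k)" using elim by (auto simp: A_def)
      have "char (distr N borel (\<lambda>\<omega>. dev n \<omega> / (a n * A))) t =
          expectation (\<lambda>\<omega>. iexp (t / A * mart n \<omega>))"
        unfolding char_def by (subst integral_distr) (auto simp: mart_def mult_ac)
      \<comment> \<open>With this scaling the Gaussian comparison term is exactly exp(-t^2/2) for
        each such \<open>n\<close>.\<close>
      moreover have "(t / A)\<^sup>2 * (\<Sum>k<n. s k) = t\<^sup>2"
        using A by (simp add: power_divide flip: A(2))
      ultimately have "norm (char (distr N borel (\<lambda>\<omega>. dev n \<omega> / (a n * A))) t - of_real (exp (- t\<^sup>2 / 2)))
          \<le> (\<Sum>k<n. step_error (t / A) k)"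
        using char_mart[of "t / A" n] by simp
      also have "\<dots> \<le> (\<Sum>k<n. y k / (\<Sum>k<n. s k))"
        unfolding A_def y_def using elim by (intro sum_mono step_error_le) auto
      also have "\<dots> = (\<Sum>k<n. y k) / (\<Sum>k<n. s k)" by (simp add: sum_divide_distrib)
      also have "\<dots> \<le> norm ((\<Sum>k<n. y k) / (\<Sum>k<n. s k))"
        unfolding real_norm_def by (rule abs_ge_self)
      finally show ?case unfolding A_def .
    qed
  qed
qed

end

section \<open>The dynamic elephant random walk\<close>

text \<open>For \<open>p = 0\<close> the contraction factor \<open>\<bar>2 p - 1\<bar>\<close> is \<open>1\<close>; then the mean is pushed back towards \<open>0\<close>:
  a step away from \<open>0\<close> has size at most \<open>1 - c\<close>, which bounds \<open>\<bar>\<sigma> n\<bar>\<close> by \<open>(1 - c) n + O(1)\<close>.\<close>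

lemma mean_bounded_away:
  fixes \<sigma> e al d :: "nat \<Rightarrow> real" and p c :: real
  assumes \<sigma>_abs: "\<And>n. \<bar>\<sigma> n\<bar> \<le> real n"
    and \<sigma>_Suc: "\<And>n. \<sigma> (Suc n) = \<sigma> n + e n"
    and e: "\<And>n. n \<ge> 1 \<Longrightarrow> e n = (2 * p - 1) * al n * \<sigma> n / real n + (1 - al n) * d n"
    and d: "\<And>n. \<bar>d n\<bar> \<le> 1"
    and al: "\<And>n. 0 \<le> al n" "\<And>n. al n \<le> 1"
    and p: "0 \<le> p" "p < 1"
    and c: "0 < c" "\<forall>\<^sub>F n in sequentially. c \<le> al n"
  shows "\<exists>\<epsilon>>0. \<forall>\<^sub>F n in sequentially. \<epsilon> \<le> 1 - (e n)\<^sup>2"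
proof -
  have "\<exists>\<delta>>0. \<forall>\<^sub>F n in sequentially. \<bar>(2 * p - 1) * \<sigma> n / real n\<bar> \<le> 1 - \<delta>"
  proof (cases "p = 0")
    case False
    \<comment> \<open>For 0 < p < 1 the factor \<open>\<bar>2 * p - 1\<bar>\<close> is already below
      1.\<close>
    have "\<forall>\<^sub>F n in sequentially. \<bar>(2 * p - 1) * \<sigma> n / real n\<bar> \<le> 1 - (1 - \<bar>2 * p - 1\<bar>)"
      using eventually_ge_at_top[of 1]
    proof eventually_elim
      case (elim n)
      have "\<bar>\<sigma> n / real n\<bar> \<le> 1" using \<sigma>_abs[of n] elim by simp
      from mult_left_mono[OF this, of "\<bar>2 * p - 1\<bar>"]
      show ?case by (simp add: abs_mult)
    qed
    moreover have "1 - \<bar>2 * p - 1\<bar> > 0" using p False by (simp add: abs_if)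
    ultimately show ?thesis by blast
  next
    case True
    obtain K where K: "K \<ge> 1" "\<And>n. n \<ge> K \<Longrightarrow> c \<le> al n"
      using c(2) unfolding eventually_sequentially by (metis max.bounded_iff max.cobounded2)
    have c1: "c \<le> 1" using K(2)[of K] al(2)[of K] by simp
    have bound: "\<bar>\<sigma> n\<bar> \<le> real K + 1 + (1 - c) * real n" if "n \<ge> K" for n
      using that
    proof (induction n rule: dec_induct)
      case base
      have "0 \<le> (1 - c) * real K" using c1 by simp
      then show ?case using \<sigma>_abs[of K] by linarith
    next
      case (step n)
      have n: "n \<ge> 1" "c \<le> al n" using step K by auto
      define m where "m = \<sigma> n / real n"
      have m: "\<bar>m\<bar> \<le> 1" using \<sigma>_abs[of n] n by (simp add: m_def)
      have e_n: "e n = (1 - al n) * d n - al n * m"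
        using e[OF n(1)] True by (simp add: m_def)
      have d_abs: "\<bar>(1 - al n) * d n\<bar> \<le> 1 - al n"
        using mult_left_mono[OF d[of n], of "1 - al n"] al(2)[of n] by (simp add: abs_mult)
      have m_abs: "\<bar>al n * m\<bar> \<le> al n"
        using mult_left_mono[OF m al(1)[of n]] al(1)[of n] by (simp add: abs_mult)
      define w where "w = (1 - c) * real n"
      have pos: "0 \<le> w" using c1 by (simp add: w_def)
      have w_Suc: "(1 - c) * real (Suc n) = 1 - c + w" by (simp add: w_def algebra_simps)
      have IH: "\<bar>\<sigma> n\<bar> \<le> real K + 1 + w" using step.IH by (simp only: w_def)
      show ?case
      \<comment> \<open>On either side of 0 the memory term points back, so only the driving term
        moves outwards. An inward step passes 0 by at most 1, which the additive constant
        covers.\<close>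
      proof (cases "\<sigma> n \<ge> 0")
        case True
        then have "0 \<le> al n * m" using al(1)[of n] by (simp add: m_def)
        then have "e n \<le> 1 - c" "- 1 \<le> e n" using e_n d_abs m_abs n(2) by linarith+
        then show ?thesis using True pos c1 IH unfolding \<sigma>_Suc w_Suc by linarith
      next
        case False
        then have "al n * m \<le> 0" using al(1)[of n]
          by (simp add: m_def mult_nonneg_nonpos divide_nonpos_nonneg)
        then have "- (1 - c) \<le> e n" "e n \<le> 1" using e_n d_abs m_abs n(2) by linarith+
        then show ?thesis using False pos c1 IH unfolding \<sigma>_Suc w_Suc by linarith
      qed
    qed
    \<comment> \<open>Beyond \<open>L\<close> the additive constant is at most c n/2, which weakens
      the slope from 1 - c to 1 - c/2.\<close>
    obtain L :: nat where L: "2 * (real K + 1) / c \<le> real L" using real_arch_simple by blast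
    have "\<bar>(2 * p - 1) * \<sigma> n / real n\<bar> \<le> 1 - c / 2" if n: "n \<ge> max K L" for n
    proof -
      have n1: "real n > 0" using n K by simp
      have "2 * (real K + 1) \<le> c * real n"
      proof -
        have "2 * (real K + 1) \<le> c * real L" using L c(1) by (simp add: field_simps)
        also have "\<dots> \<le> c * real n" using n c(1) by (intro mult_left_mono) auto
        finally show ?thesis .
      qed
      then have "\<bar>\<sigma> n\<bar> \<le> (1 - c / 2) * real n"
        using bound[of n] n by (simp add: algebra_simps)
      then show ?thesis using True n1 by (simp add: abs_mult abs_divide divide_le_eq)
    qed
    then show ?thesis
      by (intro exI[of _ "c / 2"] conjI eventually_sequentiallyI[of "max K L"]) (use c in auto)
  qed
  then obtain \<delta> where \<delta>: "\<delta> > 0" "\<forall>\<^sub>F n in sequentially. \<bar>(2 * p - 1) * \<sigma> n / real n\<bar> \<le> 1 - \<delta>"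
    by blast
  \<comment> \<open>\<open>e n\<close> is a convex combination: a term of size at most 1 - \<delta>
    has weight at least \<open>c\<close>, and the other has size at most 1.\<close>
  have "\<forall>\<^sub>F n in sequentially. c * \<delta> \<le> 1 - (e n)\<^sup>2"
    using \<delta>(2) c(2) eventually_ge_at_top[of 1]
  proof eventually_elim
    case (elim n)
    have "\<bar>e n\<bar> \<le> al n * \<bar>(2 * p - 1) * \<sigma> n / real n\<bar> + (1 - al n) * \<bar>d n\<bar>"
    proof -
      have "e n = al n * ((2 * p - 1) * \<sigma> n / real n) + (1 - al n) * d n"
        using e[of n] elim by simp
      also have "\<bar>\<dots>\<bar> \<le> \<bar>al n * ((2 * p - 1) * \<sigma> n / real n)\<bar> + \<bar>(1 - al n) * d n\<bar>"
        by (rule abs_triangle_ineq)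
      finally show ?thesis using al[of n] by (simp add: abs_mult)
    qed
    also have "\<dots> \<le> al n * (1 - \<delta>) + (1 - al n) * 1"
      using elim al[of n] d[of n] by (intro add_mono mult_left_mono) auto
    also have "\<dots> = 1 - al n * \<delta>" by (simp add: algebra_simps)
    also have "\<dots> \<le> 1 - c * \<delta>"
      using elim \<delta>(1) by (simp add: mult_right_mono)
    finally have *: "\<bar>e n\<bar> \<le> 1 - c * \<delta>" .
    \<comment> \<open>Positivity gives \<open>\<bar>e n\<bar> \<le> 1\<close>, so the square is at
      most the absolute value.\<close>
    have "0 < c * \<delta>" using c(1) \<delta>(1) by simp
    then have "\<bar>e n\<bar> * \<bar>e n\<bar> \<le> \<bar>e n\<bar> * 1" using * by (intro mult_left_mono) auto
    with * show ?case by (simp add: power2_eq_square)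
  qed
  then show ?thesis using c(1) \<delta>(1) by (intro exI[of _ "c * \<delta>"]) auto
qed

text \<open>Without generators the sigma-algebra is trivial, so the preimage of an attained value is
  the whole space.\<close>

lemma measurable_history_0_const:
  fixes h :: "'w \<Rightarrow> real"
  assumes h: "h \<in> borel_measurable (history M X 0)" and \<omega>: "\<omega> \<in> space M" "\<omega>' \<in> space M"
  shows "h \<omega>' = h \<omega>"
proof -
  have "h -` {h \<omega>} \<inter> space M \<in> sets (history M X 0)"
    using measurable_sets[OF h, of "{h \<omega>}"] by simp
  then have "h -` {h \<omega>} \<inter> space M \<in> {{}, space M}"
    by (simp add: sets_history sigma_sets_empty_eq)
  with \<omega> show ?thesis by blast
qed

section \<open>Reduction of the dynamic elephant random walk to the abstract setting\<close>

context derw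
begin

abbreviation coeff :: "nat \<Rightarrow> real" where
  "coeff n \<equiv> (2 * p - 1) * g \<alpha> (Suc n)"

text \<open>The mean of a step that takes the value 1 with probability
  \<open>f ((T ^^ Suc n) x)\<close> and -1 otherwise.\<close>

abbreviation drive :: "'x \<Rightarrow> nat \<Rightarrow> real" where
  "drive x n \<equiv> 2 * f ((T ^^ Suc n) x) - 1"

lemma \<alpha>_range: "0 \<le> g \<alpha> (Suc n)" "g \<alpha> (Suc n) \<le> 1"
  using g_range[OF \<alpha>_dom[of "Suc n"]] by auto

lemma coeff_abs: "\<bar>coeff n\<bar> \<le> 1"
proof -
  have "\<bar>2 * p - 1\<bar> \<le> 1" using p_range by (auto simp: abs_le_iff)
  then show ?thesis
    unfolding abs_mult using \<alpha>_range[of n] by (intro mult_le_one) auto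
qed

lemma orbit_in_space: "x \<in> space \<mu> \<Longrightarrow> (T ^^ n) x \<in> space \<mu>"
  by (induction n) (auto intro: measurable_space[OF T_measurable])

lemma drive_abs: "x \<in> space \<mu> \<Longrightarrow> \<bar>drive x n\<bar> \<le> 1"
  using f_range[OF orbit_in_space[of x "Suc n"]] by (auto simp: abs_le_iff)

text \<open>For \<open>n = 0\<close> both products are empty and the division by zero contributes
  0.\<close>

lemma a_coeff_Suc: "a_coeff p g \<alpha> (Suc n) = a_coeff p g \<alpha> n * (1 + coeff n / real n)"
  by (cases n) (simp_all add: a_coeff_def prod.atLeastLessThan_Suc)

text \<open>Only the factor at \<open>j = 1\<close> could vanish, namely if
  \<open>coeff 1 = - 1\<close>, which \<open>nondegenerate\<close> excludes; for larger
  \<open>j\<close> the correction is at most 1/2 in absolute value.\<close>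

lemma a_coeff_pos: "0 < a_coeff p g \<alpha> n"
  unfolding a_coeff_def
proof (rule prod_pos)
  fix j assume "j \<in> {1..<n}"
  then consider "j = 1" | "j \<ge> 2" by force
  then show "0 < 1 + (2 * p - 1) * g \<alpha> (j + 1) / real j"
  proof cases
    case 1
    have "-1 < coeff 1"
    proof (cases "p = 0")
      case True
      then show ?thesis using nondegenerate \<alpha>_range[of 1] by (auto simp: numeral_2_eq_2)
    next
      case False
      show ?thesis
      proof (cases "2 * p - 1 \<ge> 0")
        case True
        then show ?thesis using \<alpha>_range[of 1] by (smt (verit) mult_nonneg_nonneg)
      next
        case neg: False
        have "2 * p - 1 \<le> coeff 1"
          using mult_left_mono_neg[OF \<alpha>_range(2)[of 1], of "2 * p - 1"] neg by simp
        then show ?thesis using False p_range by auto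
      qed
    qed
    then show ?thesis using 1 by simp
  next
    case 2
    then show ?thesis using coeff_abs[of j] by (simp add: field_simps abs_le_iff)
  qed
qed

lemma space_P: "x \<in> space \<mu> \<Longrightarrow> space (P x) = space \<Omega>"
  using sets_eq_imp_space_eq[OF P_sets] .

lemma X_measurable_P: "x \<in> space \<mu> \<Longrightarrow> n \<ge> 1 \<Longrightarrow> X n \<in> borel_measurable (P x)"
  using X_measurable[of n] measurable_cong_sets[OF P_sets refl] by blast

text \<open>The step equals \<open>2 * I - 1\<close> for the indicator \<open>I\<close> of the value
  1, so its conditional mean follows from one conditional probability. The defining property of
  conditional expectation turns \<open>X_next\<close> into an identity of integrals.\<close>

lemma conditional_mean_X:
  assumes x: "x \<in> space \<mu>" and n: "n \<ge> 1"
    and h: "h \<in> borel_measurable (history (P x) X n)"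
    and B: "\<And>\<omega>. \<omega> \<in> space (P x) \<Longrightarrow> \<bar>h \<omega>\<bar> \<le> B"
  shows "(\<integral>\<omega>. h \<omega> * X (Suc n) \<omega> \<partial>P x) =
    (\<integral>\<omega>. h \<omega> * (coeff n * walk X n \<omega> / real n + (1 - g \<alpha> (Suc n)) * drive x n) \<partial>P x)"
proof -
  interpret N: prob_space "P x" using x by (rule P_prob)
  let ?F = "history (P x) X n"
  let ?A = "{\<omega> \<in> space \<Omega>. X (n + 1) \<omega> = 1}"
  define I :: "'w \<Rightarrow> real" where "I = indicator ?A"
  \<comment> \<open>The conditional probability of the value 1, written as half of one plus the
    conditional mean.\<close>
  define \<pi> where "\<pi> = (\<lambda>\<omega>. (1 + coeff n * walk X n \<omega> / real n + (1 - g \<alpha> (Suc n)) * drive x n) / 2)"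
  have sub: "subalgebra (P x) ?F"
    by (rule subalgebra_history) (rule X_measurable_P[OF x])
  interpret finite_measure_subalgebra "P x" ?F
    by unfold_locales (rule sub)
  have [measurable]: "X (Suc n) \<in> borel_measurable (P x)" by (simp add: X_measurable_P[OF x])
  have "?A \<in> sets (P x)"
    unfolding space_P[OF x, symmetric] Suc_eq_plus1[symmetric] by measurable
  then have I_meas [measurable]: "I \<in> borel_measurable (P x)"
    unfolding I_def by (rule borel_measurable_indicator)
  have h_meas [measurable]: "h \<in> borel_measurable (P x)"
    using measurable_from_subalg[OF sub h] .
  have int_h: "integrable (P x) h"
    using B by (intro N.integrable_const_bound[where B = B]) auto
  have int_hI: "integrable (P x) (\<lambda>\<omega>. h \<omega> * I \<omega>)"
  proof (rule Bochner_Integration.integrable_bound[OF int_h])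
    show "AE \<omega> in P x. norm (h \<omega> * I \<omega>) \<le> norm (h \<omega>)"
      by (simp add: I_def indicator_def)
  qed simp
  have \<pi>: "g \<alpha> (n + 1) * (1 / (2 * real n) * (\<Sum>k = 1..n. 1 + (2 * p - 1) * X k \<omega> * 1))
      + (1 - g \<alpha> (n + 1)) * dyn_step T f x (n + 1) 1 = \<pi> \<omega>" for \<omega>
  proof -
    have sum_eq: "(\<Sum>k = 1..n. 1 + (2 * p - 1) * X k \<omega> * 1) = real n + (2 * p - 1) * walk X n \<omega>"
      by (simp add: sum.distrib walk_def sum_distrib_left)
    show ?thesis
      unfolding sum_eq using n by (simp add: \<pi>_def dyn_step_def field_simps)
  qed
  have "AE \<omega> in P x. real_cond_exp (P x) ?F I \<omega> = \<pi> \<omega>"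
    using X_next[OF x n, of 1] unfolding I_def[symmetric] \<pi> by simp
  then have ae: "AE \<omega> in P x. h \<omega> * real_cond_exp (P x) ?F I \<omega> = h \<omega> * \<pi> \<omega>"
    by eventually_elim simp
  have [measurable]: "walk X n \<in> borel_measurable (P x)"
    unfolding walk_def[abs_def] by (intro borel_measurable_sum X_measurable_P[OF x]) auto
  have [measurable]: "\<pi> \<in> borel_measurable (P x)" unfolding \<pi>_def by measurable
  have h\<pi>_meas: "(\<lambda>\<omega>. h \<omega> * \<pi> \<omega>) \<in> borel_measurable (P x)" by measurable
  note ce = real_cond_exp_intg[OF int_hI h I_meas]
  note ce_meas = borel_measurable_integrable[OF ce(1)]
  have eq: "(\<integral>\<omega>. h \<omega> * I \<omega> \<partial>P x) = (\<integral>\<omega>. h \<omega> * \<pi> \<omega> \<partial>P x)"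
    using integral_cong_AE[OF ce_meas h\<pi>_meas ae] ce(2) by simp
  have int_h\<pi>: "integrable (P x) (\<lambda>\<omega>. h \<omega> * \<pi> \<omega>)"
    using integrable_cong_AE[OF ce_meas h\<pi>_meas ae] ce(1) by blast
  have "(\<integral>\<omega>. h \<omega> * X (Suc n) \<omega> \<partial>P x) = (\<integral>\<omega>. 2 * (h \<omega> * I \<omega>) - h \<omega> \<partial>P x)"
  proof (rule Bochner_Integration.integral_cong[OF refl])
    fix \<omega> assume "\<omega> \<in> space (P x)"
    then have XI: "X (Suc n) \<omega> = 2 * I \<omega> - 1"
      using X_range[of "Suc n" \<omega>] by (auto simp: I_def space_P[OF x])
    show "h \<omega> * X (Suc n) \<omega> = 2 * (h \<omega> * I \<omega>) - h \<omega>"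
      unfolding XI by (simp add: algebra_simps)
  qed
  also have "\<dots> = (\<integral>\<omega>. 2 * (h \<omega> * \<pi> \<omega>) - h \<omega> \<partial>P x)"
    using int_h int_hI int_h\<pi> eq by simp
  also have "\<dots> = (\<integral>\<omega>. h \<omega> * (coeff n * walk X n \<omega> / real n + (1 - g \<alpha> (Suc n)) * drive x n) \<partial>P x)"
    by (rule Bochner_Integration.integral_cong) (simp_all add: \<pi>_def field_simps)
  finally show ?thesis .
qed

lemma walk_integrable_P:
  assumes x: "x \<in> space \<mu>"
  shows "integrable (P x) (walk X n)"
proof -
  interpret N: prob_space "P x" using x by (rule P_prob)
  have "integrable (P x) (X k)" if "k \<ge> 1" for k
  proof (rule N.integrable_const_bound[where B = 1])
    show "AE \<omega> in P x. norm (X k \<omega>) \<le> 1"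
      using X_range[OF that] by (intro AE_I2) (fastforce simp: space_P[OF x])
  qed (rule X_measurable_P[OF x that])
  then show ?thesis unfolding walk_def[abs_def] by (intro Bochner_Integration.integrable_sum) auto
qed

lemma expectation_X_Suc:
  assumes x: "x \<in> space \<mu>" and n: "n \<ge> 1"
  shows "(\<integral>\<omega>. X (Suc n) \<omega> \<partial>P x) =
    coeff n * (\<integral>\<omega>. walk X n \<omega> \<partial>P x) / real n + (1 - g \<alpha> (Suc n)) * drive x n"
proof -
  interpret N: prob_space "P x" using x by (rule P_prob)
  show ?thesis
    using conditional_mean_X[OF x n, of "\<lambda>_. 1" 1] walk_integrable_P[OF x, of n]
    by (simp add: N.prob_space)
qed

lemma linear_walk: "x \<in> space \<mu> \<Longrightarrow> linear_walk (P x) coeff X"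
proof -
  assume x: "x \<in> space \<mu>"
  interpret N: prob_space "P x" using x by (rule P_prob)
  show ?thesis
  proof
    show "\<bar>coeff n\<bar> \<le> 1" for n by (rule coeff_abs)
    show "X n \<in> borel_measurable (P x)" if "n \<ge> 1" for n by (rule X_measurable_P[OF x that])
    show "X n \<omega> \<in> {- 1, 1}" if "n \<ge> 1" "\<omega> \<in> space (P x)" for n \<omega>
      using X_range[of n \<omega>] that by (simp add: space_P[OF x])
    fix n B and h :: "'w \<Rightarrow> real"
    assume h: "h \<in> borel_measurable (history (P x) X n)"
      and B: "\<And>\<omega>. \<omega> \<in> space (P x) \<Longrightarrow> \<bar>h \<omega>\<bar> \<le> B"
    show "N.expectation (\<lambda>\<omega>. h \<omega> * X (Suc n) \<omega>) = N.expectation (\<lambda>\<omega>. h \<omega> *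
      (N.expectation (X (Suc n)) + coeff n * (walk X n \<omega> - N.expectation (walk X n)) / real n))"
    proof (cases "n = 0")
      case True
      \<comment> \<open>Before the first step every test function is constant and leaves the
        integral.\<close>
      obtain \<omega>0 where \<omega>0: "\<omega>0 \<in> space (P x)" using N.not_empty by blast
      have const: "h \<omega> = h \<omega>0" if "\<omega> \<in> space (P x)" for \<omega>
        using measurable_history_0_const[OF _ \<omega>0 that, of h X] h True by simp
      have "N.expectation (\<lambda>\<omega>. h \<omega> * u \<omega>) = h \<omega>0 * N.expectation u" for u
      proof -
        have "N.expectation (\<lambda>\<omega>. h \<omega> * u \<omega>) = N.expectation (\<lambda>\<omega>. h \<omega>0 * u \<omega>)"
          by (rule Bochner_Integration.integral_cong) (auto simp: const)
        then show ?thesis by simp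
      qed
      note this[of "X (Suc 0)"] this[of "\<lambda>_. N.expectation (X (Suc 0))"]
      then show ?thesis using True by (auto simp: N.prob_space)
    next
      case False
      then have n: "n \<ge> 1" by simp
      \<comment> \<open>Inserting the formula for the mean of the step cancels the mean of the walk
        and leaves the uncentred identity.\<close>
      have recentre: "b * m / r + D + b * (s - m) / r = b * s / r + D" for b m r D s :: real
        by (simp add: right_diff_distrib diff_divide_distrib)
      show ?thesis
        unfolding expectation_X_Suc[OF x n] recentre by (rule conditional_mean_X[OF x n h B])
    qed
  qed
qed

text \<open>If \<open>p \<le> 3 / 4\<close> then \<open>2 * p - 1\<close> is itself at most 1/2.
  Otherwise the upper limit forces the memory weight below \<open>1 / (4 * p - 2)\<close>, half the
  reciprocal of \<open>2 * p - 1\<close>.\<close>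

lemma coeff_eventually_le_half:
  assumes "p \<le> 3 / 4 \<or> ell_sup g \<alpha> < ereal (1 / (4 * p - 2))"
  shows "\<forall>\<^sub>F n in sequentially. coeff n \<le> 1 / 2"
proof (cases "p \<le> 3 / 4")
  case True
  have "coeff n \<le> 1 / 2" for n
    using mult_right_mono[of "2 * p - 1" "1 / 2" "g \<alpha> (Suc n)"] \<alpha>_range[of n] True by simp
  then show ?thesis by simp
next
  case False
  then have "\<forall>\<^sub>F n in sequentially. ereal (g \<alpha> n) < ereal (1 / (4 * p - 2))"
    using assms unfolding ell_sup_def by (intro Limsup_lessD) auto
  then have "\<forall>\<^sub>F n in sequentially. g \<alpha> (Suc n) < 1 / (4 * p - 2)"
    by (subst eventually_sequentially_Suc) simp
  then show ?thesis
    by eventually_elim (use False in \<open>simp add: field_simps\<close>)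
qed

end

theorem theorem3:
  fixes \<mu> :: "'x measure" and T :: "'x \<Rightarrow> 'x" and f :: "'x \<Rightarrow> real"
    and p q :: real and R :: "(real \<times> nat) set" and g :: "real \<Rightarrow> nat \<Rightarrow> real" and \<alpha> :: real
    and \<Omega> :: "'w measure" and P :: "'x \<Rightarrow> 'w measure" and X :: "nat \<Rightarrow> 'w \<Rightarrow> real"
  assumes "derw \<mu> T f p q R g \<alpha> \<Omega> P X"
    and "p \<le> 3 / 4 \<or> ell_sup g \<alpha> < ereal (1 / (4 * p - 2))"
  shows "\<forall>x \<in> space \<mu>. p < 1 \<and> ell_inf g \<alpha> > 0 \<longrightarrow>
    weak_conv_m
      (\<lambda>n. distr (P x) borel
        (\<lambda>\<omega>. (walk X n \<omega> - integral\<^sup>L (P x) (walk X n)) / (a_coeff p g \<alpha> n * A_coeff p g \<alpha> (P x) X n)))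
      std_normal_distribution"
proof (intro ballI impI)
  interpret derw \<mu> T f p q R g \<alpha> \<Omega> P X by fact
  fix x assume x: "x \<in> space \<mu>" and *: "p < 1 \<and> ell_inf g \<alpha> > 0"
  interpret N: linear_walk "P x" coeff X by (rule linear_walk[OF x])
  \<comment> \<open>A real number strictly between 0 and the lower limit is eventually a lower bound
    for the memory weight.\<close>
  obtain c where c: "0 < ereal c" "ereal c < ell_inf g \<alpha>"
    using ereal_dense2[of 0 "ell_inf g \<alpha>"] * by (auto simp: zero_ereal_def)
  have "\<forall>\<^sub>F n in sequentially. ereal c < ereal (g \<alpha> n)"
    using c(2) unfolding ell_inf_def by (rule less_LiminfD)
  then have "\<forall>\<^sub>F n in sequentially. c \<le> g \<alpha> (Suc n)"
    by (subst eventually_sequentially_Suc) (auto elim: eventually_mono)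
  then have "\<exists>\<epsilon>>0. \<forall>\<^sub>F n in sequentially. \<epsilon> \<le> 1 - (N.expectation (X (Suc n)))\<^sup>2"
    using p_range * c(1)
    by (intro mean_bounded_away[where \<sigma> = "\<lambda>n. N.expectation (walk X n)" and p = p and c = c
          and al = "\<lambda>n. g \<alpha> (Suc n)" and d = "drive x"])
      (auto simp: N.expectation_walk_abs N.expectation_walk_Suc expectation_X_Suc[OF x]
        drive_abs[OF x] \<alpha>_range simp del: funpow.simps)
  then obtain \<epsilon> where \<epsilon>: "\<epsilon> > 0" "\<forall>\<^sub>F n in sequentially. \<epsilon> \<le> 1 - (N.expectation (X (Suc n)))\<^sup>2"
    by blast
  interpret N: linear_walk_clt "P x" coeff "a_coeff p g \<alpha>" X \<epsilon>
    using a_coeff_pos a_coeff_Suc coeff_eventually_le_half[OF assms(2)] \<epsilon> by unfold_locales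
  \<comment> \<open>The sum over 1 to \<open>n\<close> becomes a sum over \<open>k < n\<close>,
    since \<open>N.s k\<close> refers to step \<open>Suc k\<close>.\<close>
  have "A_coeff p g \<alpha> (P x) X n = sqrt (\<Sum>k<n. N.s k)" for n
    by (simp add: A_coeff_def N.s_def sum.atLeast1_atMost_eq)
  with N.central_limit show "weak_conv_m
      (\<lambda>n. distr (P x) borel
        (\<lambda>\<omega>. (walk X n \<omega> - integral\<^sup>L (P x) (walk X n)) / (a_coeff p g \<alpha> n * A_coeff p g \<alpha> (P x) X n)))
      std_normal_distribution"
    by (simp add: N.dev_def)
qed

end
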